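(* Let $G=\ast_{j\in J} A_j$ be a free product of nontrivial groups and let $n$ be a positive integer. If $a\in A_{j_1}$ and $t\in A_{j_2}$ are nonidentity elements with $j_1\neq j_2$ and $\mathrm{ord}(a)\le \mathrm{ord}(t)$, then $$\mathrm{cl}([a,t]^n) = \left\lfloor \frac{n}{2}\right\rfloor - \left\lfloor \frac{n}{\mathrm{ord}(a)}\right\rfloor + 1.$$
   Context: $[x,y]=x^{-1}y^{-1}xy$. The commutator length $\mathrm{cl}(h)$ of an element $h$ of the commutator subgroup of a group is the minimal $k$ such that $h$ is a product of $k$ commutators. $\mathrm{ord}(a)$ is the order of $a$ (possibly $\infty$); if $\mathrm{ord}(a)=\infty$, the term $\lfloor n/\mathrm{ord}(a)\rfloor$ is interpreted as $0$. $\lfloor x\rfloor$ denotes the integer part of $x$. *)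

theory Defs
  imports "HOL-Algebra.Multiplicative_Group" "HOL-Library.Extended_Nat"
begin

(* Free product of a family of groups A j (j \<in> J), realised concretely as the group of
   reduced words: lists of letters (j, x) with j \<in> J, x \<in> carrier (A j) - {1}, and
   consecutive letters from different factors. Multiplication = concatenation + reduction. *)

fun fp_push :: "('j \<Rightarrow> 'a monoid) \<Rightarrow> 'j \<times> 'a \<Rightarrow> ('j \<times> 'a) list \<Rightarrow> ('j \<times> 'a) list" where
  "fp_push A (j, x) [] = (if x = \<one>\<^bsub>A j\<^esub> then [] else [(j, x)])"
| "fp_push A (j, x) ((k, y) # w) =
     (if x = \<one>\<^bsub>A j\<^esub> then (k, y) # w
      else if j = k then (if x \<otimes>\<^bsub>A j\<^esub> y = \<one>\<^bsub>A j\<^esub> then w else (j, x \<otimes>\<^bsub>A j\<^esub> y) # w)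
      else (j, x) # (k, y) # w)"

definition reduced_word :: "('j \<Rightarrow> 'a monoid) \<Rightarrow> 'j set \<Rightarrow> ('j \<times> 'a) list \<Rightarrow> bool" where
  "reduced_word A J w \<longleftrightarrow>
     (\<forall>(j, x) \<in> set w. j \<in> J \<and> x \<in> carrier (A j) \<and> x \<noteq> \<one>\<^bsub>A j\<^esub>) \<and>
     successively (\<lambda>p q. fst p \<noteq> fst q) w"

definition free_product :: "('j \<Rightarrow> 'a monoid) \<Rightarrow> 'j set \<Rightarrow> ('j \<times> 'a) list monoid" where
  "free_product A J = \<lparr> carrier = {w. reduced_word A J w},
                        mult = (\<lambda>u v. foldr (fp_push A) u v),
                        one = [] \<rparr>"

definition fp_incl :: "('j \<Rightarrow> 'a monoid) \<Rightarrow> 'j \<Rightarrow> 'a \<Rightarrow> ('j \<times> 'a) list" where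
  "fp_incl A j x = (if x = \<one>\<^bsub>A j\<^esub> then [] else [(j, x)])"

definition commutator :: "('g, 'b) monoid_scheme \<Rightarrow> 'g \<Rightarrow> 'g \<Rightarrow> 'g" where
  "commutator G x y = inv\<^bsub>G\<^esub> x \<otimes>\<^bsub>G\<^esub> inv\<^bsub>G\<^esub> y \<otimes>\<^bsub>G\<^esub> x \<otimes>\<^bsub>G\<^esub> y"

definition comm_product :: "('g, 'b) monoid_scheme \<Rightarrow> (nat \<Rightarrow> 'g) \<Rightarrow> (nat \<Rightarrow> 'g) \<Rightarrow> nat \<Rightarrow> 'g" where
  "comm_product G f g k = foldr (\<lambda>i acc. commutator G (f i) (g i) \<otimes>\<^bsub>G\<^esub> acc) [0..<k] \<one>\<^bsub>G\<^esub>"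

definition commutator_length :: "('g, 'b) monoid_scheme \<Rightarrow> 'g \<Rightarrow> nat" where
  "commutator_length G h = (LEAST k. \<exists>f g. (\<forall>i<k. f i \<in> carrier G \<and> g i \<in> carrier G)
                                          \<and> h = comm_product G f g k)"

definition elem_ord :: "('g, 'b) monoid_scheme \<Rightarrow> 'g \<Rightarrow> enat" where
  "elem_ord G x = (if group.ord G x = 0 then \<infinity> else enat (group.ord G x))"

definition floor_div_ord :: "nat \<Rightarrow> enat \<Rightarrow> nat" where
  "floor_div_ord n m = (case m of enat k \<Rightarrow> n div k | \<infinity> \<Rightarrow> 0)"

end

theory Submission
  imports Defs "HOL-Combinatorics.Transposition"
begin

text \<open>
  Lower bound. A product of commutators bounds a surface mapped to a wedge of spaces for the factors;
  cutting it along the preimage of the wedge point decorates the cyclic word \<open>w\<close> with a permutation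
  \<open>\<pi>\<close> of its letters preserving the factors, whose cycles are the boundaries of the pieces. Only
  pieces that are discs, i.e. cycles with trivial label product, contribute positively to the Euler
  characteristic. Writing \<open>\<sigma>\<close> for the cyclic successor and \<open>\<pi> = \<phi> \<circ> \<sigma>\<close>, the quantity
  (number of discs) - (transposition length of \<open>\<phi>\<close>) stands in for the Euler characteristic. It does not
  decrease when adjacent letters of a factor are multiplied or a trivial letter is dropped, and
  inserting a commutator lowers it by at most 2; hence the reduced form of a product of \<open>k\<close>
  commutators carries such a permutation with value at least \<open>1 - 2k\<close>. For \<open>w = [a,t]^n\<close> one may
  assume that \<open>\<phi>\<close> is a fixed-point-free involution. A disc then either consists of equal letters, and
  has length at least \<open>ord a\<close>, or contains a transition from \<open>a^-1\<close> to \<open>a\<close> or from \<open>t^-1\<close> to \<open>t\<close>.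
  The involution turns transitions between \<open>a\<close>-letters into transitions between \<open>t\<close>-letters, so
  there are at most \<open>n\<close> discs of the second kind and \<open>2 \<lfloor>n / ord a\<rfloor>\<close> of the first.

  Upper bound. Put \<open>x = a^-1\<close> and \<open>y = t^-1 a t\<close>, so that \<open>[a,t] = x y\<close> and \<open>x^i y^i\<close> is a
  commutator. Reversing three consecutive blocks of a word costs one commutator. Such a reversal
  turns \<open>x^i y^i (xy)^(v+2)\<close> into \<open>x^(i+2) y^(i+2) (xy)^v\<close>, and when the exponents pass a multiple of
  \<open>m = ord a\<close> a single reversal absorbs four factors \<open>xy\<close> instead of two, because the vanishing of
  \<open>x^m\<close> and \<open>y^m\<close> makes further letters adjacent.
\<close>

subsection \<open>Transposition length and cyclic lists\<close>

text \<open>As \<open>transpose x x = id\<close>, this says that \<open>p\<close> is a product of at most \<open>l\<close> transpositions.\<close>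

primrec transp_prod :: "nat \<Rightarrow> ('i \<Rightarrow> 'i) \<Rightarrow> bool" where
  "transp_prod 0 p \<longleftrightarrow> p = id"
| "transp_prod (Suc l) p \<longleftrightarrow> (\<exists>x y q. transp_prod l q \<and> p = transpose x y \<circ> q)"

lemma transp_prod_step: "transp_prod l p \<Longrightarrow> transp_prod (Suc l) (transpose x y \<circ> p)"
  by auto

lemma transp_prod_Suc: "transp_prod l p \<Longrightarrow> transp_prod (Suc l) p"
  using transp_prod_step[of l p undefined undefined] by simp

lemma transp_prod_mono: "transp_prod l p \<Longrightarrow> l \<le> l' \<Longrightarrow> transp_prod l' p"
  by (rule dec_induct[of l l' "\<lambda>l. transp_prod l p"]) (auto intro: transp_prod_Suc simp del: transp_prod.simps)

lemma transp_prod_bij: "transp_prod l p \<Longrightarrow> bij p"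
proof (induction l arbitrary: p)
  case (Suc l)
  then obtain x y q where q: "transp_prod l q" and p: "p = transpose x y \<circ> q" by auto
  show ?case unfolding p by (rule bij_comp[OF Suc.IH[OF q]]) simp
qed simp

lemma comp_transpose_eq: "bij p \<Longrightarrow> p \<circ> transpose x y = transpose (p x) (p y) \<circ> p"
  by (auto simp: fun_eq_iff transpose_def bij_def dest: injD)

lemma transp_prod_right: "transp_prod l p \<Longrightarrow> transp_prod (Suc l) (p \<circ> transpose x y)"
  using transp_prod_step[of l p "p x" "p y"] by (simp only: comp_transpose_eq[OF transp_prod_bij])

lemma transp_prod_support:
  "transp_prod l p \<Longrightarrow> finite {x. p x \<noteq> x} \<and> card {x. p x \<noteq> x} \<le> 2 * l"
proof (induction l arbitrary: p)
  case (Suc l)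
  then obtain a b q where q: "transp_prod l q" and p: "p = transpose a b \<circ> q" by auto
  from Suc.IH[OF q] have fin: "finite {x. q x \<noteq> x}" and le: "card {x. q x \<noteq> x} \<le> 2 * l"
    by blast+
  have sub: "{x. p x \<noteq> x} \<subseteq> {x. q x \<noteq> x} \<union> {a, b}"
  proof
    fix x assume "x \<in> {x. p x \<noteq> x}"
    moreover have "p x = x" if "q x = x" "x \<noteq> a" "x \<noteq> b" using that by (simp add: p)
    ultimately show "x \<in> {x. q x \<noteq> x} \<union> {a, b}" by blast
  qed
  have "card {x. p x \<noteq> x} \<le> card ({x. q x \<noteq> x} \<union> {a, b})"
    using fin sub by (intro card_mono) auto
  also have "\<dots> \<le> card {x. q x \<noteq> x} + card {a, b}" by (rule card_Un_le)
  also have "card {a, b} \<le> 2" by (simp add: card_insert_if)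
  finally have "card {x. p x \<noteq> x} \<le> 2 * Suc l" using le by simp
  moreover have "finite {x. p x \<noteq> x}" using finite_subset[OF sub] fin by simp
  ultimately show ?case by blast
qed simp

text \<open>This is \<open>p\<close> with \<open>i\<close> taken out of its cycle: \<open>i\<close>
  becomes a fixed point and its predecessor is sent to \<open>p i\<close>.\<close>

definition skip_point :: "'i \<Rightarrow> ('i \<Rightarrow> 'i) \<Rightarrow> 'i \<Rightarrow> 'i" where
  "skip_point i p = transpose i (p i) \<circ> p"

text \<open>Taking a moved point out of its cycle saves one transposition. Induction over the
  product does without counting cycles: the leftmost factor either is what moves \<open>i\<close>
  and drops out, or has already taken \<open>i\<close> out of the cycle it has in \<open>p'\<close>,
  or can be exchanged with the removal of \<open>i\<close>.\<close>

lemma transp_prod_skip_point: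
  assumes "transp_prod l p"
  shows "transp_prod (if p i = i then l else l - 1) (skip_point i p) \<and> (p i \<noteq> i \<longrightarrow> l > 0)"
  using assms
proof (induction l arbitrary: p)
  case 0
  then show ?case by (auto simp: skip_point_def fun_eq_iff)
next
  case (Suc l)
  then obtain x y p' where p': "transp_prod l p'" and p: "p = transpose x y \<circ> p'" by auto
  let ?t = "transpose x y"
  show ?case
  proof (cases "p' i = i")
    case True
    show ?thesis
    proof (cases "?t i = i")
      case True
      with \<open>p' i = i\<close> have "p i = i" by (simp add: p)
      then have "skip_point i p = p" by (auto simp: skip_point_def fun_eq_iff)
      then show ?thesis using Suc.prems \<open>p i = i\<close> by presburger
    next
      case False
      then have "transpose i (?t i) = ?t" by (auto simp: transpose_def fun_eq_iff split: if_splits)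
      then have "skip_point i p = p'" using True by (auto simp: skip_point_def p fun_eq_iff)
      moreover have "p i \<noteq> i" using True False by (simp add: p)
      ultimately show ?thesis using p' by simp
    qed
  next
    case False
    define a where "a = p' i"
    from False Suc.IH[OF p'] have IH: "transp_prod (l - 1) (skip_point i p')" "l > 0" by simp_all
    have sp: "skip_point i p' = transpose i a \<circ> p'" by (simp add: skip_point_def a_def)
    have pi: "p i = ?t a" by (simp add: p a_def)
    show ?thesis
    proof (cases "?t a = i")
      case True
      then have "?t = transpose i a" using False unfolding a_def
        by (auto simp: transpose_def fun_eq_iff split: if_splits)
      then have "p = skip_point i p'" by (simp add: p sp)
      moreover have "skip_point i p = p" using pi True by (auto simp: skip_point_def fun_eq_iff)
      ultimately have "transp_prod (Suc l) (skip_point i p)"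
        using transp_prod_mono[OF IH(1), of "Suc l"] by simp
      then show ?thesis using True pi by presburger
    next
      case ta: False
      have "\<exists>u v. transpose i (?t a) \<circ> ?t = transpose u v \<circ> transpose i a"
      proof (cases "?t i = i")
        case True
        then have "transpose i (?t a) \<circ> ?t = ?t \<circ> transpose i a"
          using comp_transpose_eq[of ?t i a] by simp
        then show ?thesis by blast
      next
        case False
        define b where "b = ?t i"
        have "?t = transpose i b" using False unfolding b_def
          by (auto simp: transpose_def fun_eq_iff split: if_splits)
        moreover have "a \<noteq> b" using ta unfolding b_def by auto
        ultimately have "transpose i (?t a) \<circ> ?t = transpose b a \<circ> transpose i a"
          using ta False \<open>p' i \<noteq> i\<close> unfolding a_def[symmetric] b_def[symmetric]
          by (auto simp: transpose_def fun_eq_iff)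
        then show ?thesis by blast
      qed
      then obtain u v where "transpose i (?t a) \<circ> ?t = transpose u v \<circ> transpose i a" by blast
      then have "skip_point i p = transpose u v \<circ> skip_point i p'"
        unfolding sp by (metis o_assoc p pi skip_point_def)
      then have "transp_prod (Suc (l - 1)) (skip_point i p)"
        using transp_prod_step[OF IH(1)] by presburger
      then show ?thesis using IH(2) ta pi by simp
    qed
  qed
qed

lemma transp_prod_skip:
  assumes "transp_prod l p" "p i \<noteq> i"
  shows "\<exists>l'. l = Suc l' \<and> transp_prod l' (transpose i (p i) \<circ> p)"
  using transp_prod_skip_point[OF assms(1), of i] assms(2) by (cases l) (auto simp: skip_point_def)

section \<open>Cycles of a permutation, written as lists\<close>

definition cyclic_on :: "('i \<Rightarrow> 'i) \<Rightarrow> 'i list \<Rightarrow> bool" where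
  "cyclic_on f cs \<longleftrightarrow> cs \<noteq> [] \<and> distinct cs \<and> successively (\<lambda>x y. f x = y) cs \<and> f (last cs) = hd cs"

lemma cyclic_on_rotate: "cyclic_on f (u @ v) \<Longrightarrow> cyclic_on f (v @ u)"
  by (cases "u = []"; cases "v = []") (auto simp: cyclic_on_def successively_append_iff)

lemma cyclic_on_start:
  assumes "cyclic_on f cs" "x \<in> set cs"
  obtains r u v where "cs = u @ x # v" "r = v @ u" "cyclic_on f (x # r)"
proof -
  from assms(2) obtain u v where "cs = u @ x # v" by (auto dest: split_list)
  then show ?thesis using that[of u v "v @ u"] cyclic_on_rotate[of f u "x # v"] assms(1) by simp
qed

lemma successively_image:
  assumes "successively (\<lambda>x y. f x = y) cs" "x \<in> set cs"
  shows "x = last cs \<or> f x \<in> set (tl cs)"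
  using assms
proof (induction cs)
  case (Cons a cs)
  then show ?case by (cases cs) auto
qed simp

lemma cyclic_on_image: "cyclic_on f cs \<Longrightarrow> x \<in> set cs \<Longrightarrow> f x \<in> set cs"
  using successively_image[of f cs x] by (auto simp: cyclic_on_def dest: list.set_sel(2))

lemma cyclic_on_preimage:
  assumes "cyclic_on f cs" "f x \<in> set cs" "inj f"
  shows "x \<in> set cs"
proof -
  have "f ` set cs \<subseteq> set cs" using cyclic_on_image[OF assms(1)] by auto
  then have "f ` set cs = set cs"
    by (metis assms(3) card_image card_subset_eq finite_set inj_on_subset subset_UNIV)
  then show ?thesis using assms(2,3) by (metis imageE injD)
qed

text \<open>Only the tail has to be fixed by \<open>k\<close>, because the head is not the target of
  a step inside the list. The surgeries below redirect just the steps that enter the heads of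
  blocks.\<close>

lemma successively_comp_fixing:
  assumes "successively (\<lambda>x y. f x = y) cs" "\<And>y. y \<in> set (tl cs) \<Longrightarrow> k y = y"
  shows "successively (\<lambda>x y. (k \<circ> f) x = y) cs"
  using assms
proof (induction cs)
  case (Cons a cs)
  then show ?case by (cases cs) auto
qed simp

lemma cyclic_on_comp_fixing:
  assumes "cyclic_on f cs" "\<And>y. y \<in> set cs \<Longrightarrow> k y = y"
  shows "cyclic_on (k \<circ> f) cs"
  using assms successively_comp_fixing[of f cs k] by (auto simp: cyclic_on_def dest: list.set_sel)

lemma cyclic_on_cong:
  assumes "cyclic_on f cs" "\<And>y. y \<in> set cs \<Longrightarrow> g y = f y"
  shows "cyclic_on g cs"
proof -
  have "successively (\<lambda>x y. g x = y) cs"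
    using assms by (simp add: cyclic_on_def successively_conv_nth)
  then show ?thesis using assms by (auto simp: cyclic_on_def)
qed

text \<open>The effect of \<open>skip_point\<close> on the cycle that contains the point.\<close>

lemma cyclic_on_skip:
  assumes "cyclic_on f (e # r)" "r \<noteq> []"
  shows "cyclic_on (transpose e (f e) \<circ> f) r"
proof -
  from assms have fe: "f e = hd r" and *: "distinct r" "e \<notin> set r" "successively (\<lambda>x y. f x = y) r" "f (last r) = e"
    by (auto simp: cyclic_on_def successively_Cons)
  have "successively (\<lambda>x y. (transpose e (f e) \<circ> f) x = y) r"
  proof (rule successively_comp_fixing[OF *(3)])
    fix y assume "y \<in> set (tl r)"
    then have "y \<noteq> e" "y \<noteq> hd r" using * by (cases r; auto)+
    then show "transpose e (f e) y = y" by (simp add: fe)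
  qed
  then show ?thesis using * fe assms(2) by (simp add: cyclic_on_def)
qed

text \<open>The closing steps of the two cycles, into \<open>p\<close> and into \<open>q\<close>,
  are interchanged, so each cycle continues into the other.\<close>

lemma cyclic_on_join:
  assumes "cyclic_on f (p # u)" "cyclic_on f (q # v)" "set (p # u) \<inter> set (q # v) = {}"
  shows "cyclic_on (transpose p q \<circ> f) (p # u @ q # v)"
proof -
  have *: "successively (\<lambda>x y. (transpose p q \<circ> f) x = y) (p # u)"
    by (rule successively_comp_fixing) (use assms in \<open>auto simp: cyclic_on_def transpose_def\<close>)
  have **: "successively (\<lambda>x y. (transpose p q \<circ> f) x = y) (q # v)"
    by (rule successively_comp_fixing) (use assms in \<open>auto simp: cyclic_on_def transpose_def\<close>)
  have "successively (\<lambda>x y. (transpose p q \<circ> f) x = y) ((p # u) @ q # v)"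
    unfolding successively_append_iff using * ** assms by (auto simp: cyclic_on_def)
  then show ?thesis using assms by (auto simp: cyclic_on_def)
qed

text \<open>Composition on the right acts on arguments: \<open>last u\<close> is now sent to
  \<open>e\<close>, and \<open>e\<close> inherits the old image of \<open>last u\<close>.\<close>

lemma cyclic_on_insert:
  assumes "cyclic_on f (u @ v)" "u \<noteq> []" "e \<notin> set (u @ v)" "f e = e"
  shows "cyclic_on (f \<circ> transpose (last u) e) (u @ e # v)"
proof -
  obtain b z where u: "u = b @ [z]" using assms(2) by (cases u rule: rev_cases) auto
  let ?g = "f \<circ> transpose z e"
  have d: "distinct (b @ z # v)" and s: "successively (\<lambda>x y. f x = y) (b @ z # v)"
    and l: "f (last (z # v)) = hd (b @ [z])"
    using assms(1) by (auto simp: cyclic_on_def u hd_append)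
  have e: "e \<notin> set b" "e \<notin> set v" "e \<noteq> z" using assms(3) by (auto simp: u)
  have g: "?g x = f x" if "x \<in> set b \<union> set v" for x
    using that d e by (auto simp: transpose_def)
  have gz: "?g e = f z" "?g z = e" using assms(4) by auto
  have "successively (\<lambda>x y. f x = y) b" "successively (\<lambda>x y. f x = y) v"
    using s by (auto simp: successively_append_iff successively_Cons)
  then have sb: "successively (\<lambda>x y. ?g x = y) b" "successively (\<lambda>x y. ?g x = y) v"
    using g by (simp_all add: successively_conv_nth)
  have lb: "?g (last b) = z" if "b \<noteq> []"
    using that s g[of "last b"] by (simp add: successively_append_iff)
  have fv: "f z = hd v" if "v \<noteq> []"
    using that s by (simp add: successively_append_iff successively_Cons)
  have "successively (\<lambda>x y. ?g x = y) (z # e # v)"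
    using sb gz fv by (auto simp: successively_Cons)
  then have "successively (\<lambda>x y. ?g x = y) (b @ z # e # v)"
    using sb lb by (auto simp: successively_append_iff)
  moreover have "?g (last (e # v)) = hd (b @ [z])"
    using l gz g[of "last v"] by (cases "v = []") auto
  ultimately show ?thesis using d e by (auto simp: cyclic_on_def u hd_append)
qed

text \<open>Exchanging two adjacent blocks of a cycle redirects only the three steps entering
  \<open>p\<close>, \<open>q\<close> and \<open>r\<close>, that is, it costs one 3-cycle or two
  transpositions. This is where the loss of 2 per commutator comes from.\<close>

lemma cyclic_on_swap:
  assumes "cyclic_on f (p # u @ q # v @ r # w)"
  shows "cyclic_on (transpose p q \<circ> transpose q r \<circ> f) (q # v @ p # u @ r # w)"
proof -
  let ?k = "transpose p q \<circ> transpose q r"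
  have d: "distinct (p # u @ q # v @ r # w)" using assms by (simp add: cyclic_on_def)
  have s: "successively (\<lambda>x y. f x = y) ((p # u) @ (q # v) @ (r # w))" "f (last (r # w)) = p"
    using assms by (auto simp: cyclic_on_def)
  have f: "f (last (p # u)) = q" "f (last (q # v)) = r"
    using s(1) unfolding successively_append_iff by auto
  have s': "successively (\<lambda>x y. f x = y) (p # u)" "successively (\<lambda>x y. f x = y) (q # v)"
    "successively (\<lambda>x y. f x = y) (r # w)"
    using s(1) unfolding successively_append_iff by auto
  have 1: "successively (\<lambda>x y. (?k \<circ> f) x = y) (p # u)"
    by (rule successively_comp_fixing[OF s'(1)]) (use d in \<open>auto simp: transpose_def\<close>)
  have 2: "successively (\<lambda>x y. (?k \<circ> f) x = y) (q # v)"
    by (rule successively_comp_fixing[OF s'(2)]) (use d in \<open>auto simp: transpose_def\<close>)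
  have 3: "successively (\<lambda>x y. (?k \<circ> f) x = y) (r # w)"
    by (rule successively_comp_fixing[OF s'(3)]) (use d in \<open>auto simp: transpose_def\<close>)
  have k: "?k p = q" "?k q = r" "?k r = p" using d by (auto simp: transpose_def)
  have "successively (\<lambda>x y. (?k \<circ> f) x = y) ((q # v) @ (p # u) @ r # w)"
    unfolding successively_append_iff using 1 2 3 f s(2) k by auto
  moreover have "(?k \<circ> f) (last (r # w)) = q" using s(2) k by simp
  moreover have "distinct (q # v @ p # u @ r # w)" using d by auto
  ultimately show ?thesis unfolding cyclic_on_def by simp
qed

subsection \<open>Diagrams over a word\<close>

abbreviation disjoint_lists :: "'i list set \<Rightarrow> bool" where
  "disjoint_lists \<equiv> pairwise (\<lambda>d e. set d \<inter> set e = {})"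

lemma disjoint_lists_insert:
  assumes "finite D" "disjoint_lists D" "d \<noteq> []" "\<And>e. e \<in> D \<Longrightarrow> set e \<inter> set d = {}"
  shows "disjoint_lists (insert d D)" "card (insert d D) = Suc (card D)"
proof -
  have "d \<notin> D" using assms(3,4) by (metis Int_absorb set_empty)
  then show "card (insert d D) = Suc (card D)" using assms(1) by simp
  show "disjoint_lists (insert d D)" using assms(2,4) by (auto simp: pairwise_insert Int_commute)
qed

lemma disjoint_lists_unique:
  "disjoint_lists D \<Longrightarrow> d \<in> D \<Longrightarrow> e \<in> D \<Longrightarrow> x \<in> set d \<Longrightarrow> x \<in> set e \<Longrightarrow> d = e"
  by (auto simp: pairwise_def)

locale group_family =
  fixes A :: "'j \<Rightarrow> 'a monoid" and J :: "'j set"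
  assumes is_group: "j \<in> J \<Longrightarrow> group (A j)"
begin

definition letters :: "('j \<times> 'a) set" where
  "letters = {(j, x). j \<in> J \<and> x \<in> carrier (A j)}"

lemma in_letters: "p \<in> letters \<longleftrightarrow> fst p \<in> J \<and> snd p \<in> carrier (A (fst p))"
  by (auto simp: letters_def)

definition label_prod :: "('i \<Rightarrow> 'j \<times> 'a) \<Rightarrow> 'j \<Rightarrow> 'i list \<Rightarrow> 'a" where
  "label_prod lab j cs = foldr (\<lambda>x acc. snd (lab x) \<otimes>\<^bsub>A j\<^esub> acc) cs \<one>\<^bsub>A j\<^esub>"

definition disc :: "('i \<Rightarrow> 'j \<times> 'a) \<Rightarrow> ('i \<Rightarrow> 'i) \<Rightarrow> 'i list \<Rightarrow> bool" where
  "disc lab f d \<longleftrightarrow> cyclic_on f d \<and> lab ` set d \<subseteq> letters \<and>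
     (\<exists>j. (\<forall>x\<in>set d. fst (lab x) = j) \<and> label_prod lab j d = \<one>\<^bsub>A j\<^esub>)"

text \<open>The list \<open>c\<close> names the letter occurrences of the word \<open>map lab c\<close>, \<open>\<sigma>\<close> is the cyclic successor and
  \<open>\<phi> \<circ> \<sigma>\<close> the permutation whose cycles bound the pieces. The set \<open>D\<close> need not contain all disc cycles.\<close>

definition diagram ::
  "'i list \<Rightarrow> ('i \<Rightarrow> 'j \<times> 'a) \<Rightarrow> ('i \<Rightarrow> 'i) \<Rightarrow> ('i \<Rightarrow> 'i) \<Rightarrow> 'i list set \<Rightarrow> nat \<Rightarrow> bool" where
  "diagram c lab \<sigma> \<phi> D l \<longleftrightarrow>
     cyclic_on \<sigma> c \<and> bij \<sigma> \<and> (\<forall>x. x \<notin> set c \<longrightarrow> \<sigma> x = x \<and> \<phi> x = x) \<and> lab ` set c \<subseteq> letters \<and>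
     (\<forall>x\<in>set c. fst (lab ((\<phi> \<circ> \<sigma>) x)) = fst (lab x)) \<and> transp_prod l \<phi> \<and>
     finite D \<and> disjoint_lists D \<and> (\<forall>d\<in>D. set d \<subseteq> set c \<and> disc lab (\<phi> \<circ> \<sigma>) d)"

text \<open>Here \<open>k\<close> is a lower bound for the stand-in of the Euler characteristic.
  Occurrences are named by natural numbers, so that fresh names for inserted letters always
  exist.\<close>

definition fills :: "('j \<times> 'a) list \<Rightarrow> int \<Rightarrow> bool" where
  "fills w k \<longleftrightarrow> (\<exists>(c :: nat list) lab \<sigma> \<phi> D l.
     diagram c lab \<sigma> \<phi> D l \<and> map lab c = w \<and> k \<le> int (card D) - int l)"

lemma label_prod_Cons: "label_prod lab j (x # cs) = snd (lab x) \<otimes>\<^bsub>A j\<^esub> label_prod lab j cs"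
  and label_prod_Nil: "label_prod lab j [] = \<one>\<^bsub>A j\<^esub>"
  by (simp_all add: label_prod_def)

lemma label_prod_closed:
  assumes "j \<in> J" "\<And>x. x \<in> set cs \<Longrightarrow> lab x \<in> letters \<and> fst (lab x) = j"
  shows "label_prod lab j cs \<in> carrier (A j)"
  using assms
proof (induction cs)
  case Nil
  then show ?case using group.is_monoid[OF is_group] by (simp add: label_prod_Nil monoid.one_closed)
next
  case (Cons x cs)
  have "snd (lab x) \<in> carrier (A j)" using Cons.prems(2)[of x] by (auto simp: letters_def)
  then show ?case using Cons group.is_monoid[OF is_group]
    by (simp add: label_prod_Cons monoid.m_closed)
qed

lemma label_prod_append:
  assumes "j \<in> J" "\<And>x. x \<in> set (us @ vs) \<Longrightarrow> lab x \<in> letters \<and> fst (lab x) = j"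
  shows "label_prod lab j (us @ vs) = label_prod lab j us \<otimes>\<^bsub>A j\<^esub> label_prod lab j vs"
  using assms
proof (induction us)
  case Nil
  then show ?case using group.is_monoid[OF is_group] label_prod_closed[of j vs lab]
    by (simp add: label_prod_Nil monoid.l_one)
next
  case (Cons x us)
  have "snd (lab x) \<in> carrier (A j)" using Cons.prems(2)[of x] by (auto simp: letters_def)
  moreover have "label_prod lab j us \<in> carrier (A j)" "label_prod lab j vs \<in> carrier (A j)"
    using Cons.prems by (auto intro!: label_prod_closed)
  ultimately show ?case using Cons group.is_monoid[OF is_group[OF Cons.prems(1)]]
    by (simp add: label_prod_Cons monoid.m_assoc)
qed

lemma label_prod_cong:
  "(\<And>x. x \<in> set cs \<Longrightarrow> lab x = lab' x) \<Longrightarrow> label_prod lab j cs = label_prod lab' j cs"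
  by (induction cs) (simp_all add: label_prod_Nil label_prod_Cons)

text \<open>In a group \<open>u v = 1\<close> forces \<open>v u = 1\<close>, so triviality of the
  boundary label does not depend on where the cycle starts.\<close>

lemma disc_rotate:
  assumes "disc lab f (u @ v)"
  shows "disc lab f (v @ u)"
proof -
  from assms obtain j where j: "\<forall>x\<in>set (u @ v). fst (lab x) = j" "label_prod lab j (u @ v) = \<one>\<^bsub>A j\<^esub>"
    and c: "cyclic_on f (u @ v)" and l: "lab ` set (u @ v) \<subseteq> letters" by (auto simp: disc_def)
  have "u @ v \<noteq> []" using c by (simp add: cyclic_on_def)
  then obtain x where "x \<in> set (u @ v)" by (cases "u @ v") auto
  with l j(1) have J: "j \<in> J" by (auto simp: in_letters)
  interpret group "A j" by (rule is_group[OF J])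
  have lj: "lab x \<in> letters \<and> fst (lab x) = j" if "x \<in> set u \<union> set v" for x
    using that l j by auto
  have cl: "label_prod lab j u \<in> carrier (A j)" "label_prod lab j v \<in> carrier (A j)"
    using J lj by (auto intro!: label_prod_closed)
  have "label_prod lab j (u @ v) = label_prod lab j u \<otimes>\<^bsub>A j\<^esub> label_prod lab j v"
    by (rule label_prod_append[OF J], rule lj) simp
  moreover have "label_prod lab j (v @ u) = label_prod lab j v \<otimes>\<^bsub>A j\<^esub> label_prod lab j u"
    by (rule label_prod_append[OF J], rule lj) auto
  ultimately have "label_prod lab j (v @ u) = \<one>\<^bsub>A j\<^esub>" using j(2) inv_comm[OF _ cl] by simp
  then show ?thesis using cyclic_on_rotate[OF c] j l by (auto simp: disc_def)
qed

lemma disc_start: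
  assumes "disc lab f d" "x \<in> set d"
  obtains r where "disc lab f (x # r)" "set (x # r) = set d" "x \<notin> set r"
proof -
  from assms(2) obtain u v where "d = u @ x # v" by (auto dest: split_list)
  moreover from this assms(1) have "disc lab f (x # v @ u)" using disc_rotate[of lab f u "x # v"] by simp
  ultimately show ?thesis using that[of "v @ u"] by (auto simp: disc_def cyclic_on_def)
qed

lemma disc_comp_fixing:
  "disc lab f d \<Longrightarrow> (\<And>y. y \<in> set d \<Longrightarrow> k y = y) \<Longrightarrow> disc lab (k \<circ> f) d"
  using cyclic_on_comp_fixing[of f d k] by (simp add: disc_def)

lemma disc_cong:
  assumes "disc lab f d" "\<And>x. x \<in> set d \<Longrightarrow> lab' x = lab x" "\<And>x. x \<in> set d \<Longrightarrow> g x = f x"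
  shows "disc lab' g d"
proof -
  have "lab' ` set d = lab ` set d" using assms(2) by (auto simp: image_iff)
  moreover have "label_prod lab' j d = label_prod lab j d" for j
    using assms(2) by (intro label_prod_cong) auto
  moreover have "cyclic_on g d" using assms cyclic_on_cong[of f d g] by (simp add: disc_def)
  ultimately show ?thesis using assms by (simp add: disc_def)
qed

lemma disc_join:
  assumes "disc lab f (p # u)" "disc lab f (q # v)" "set (p # u) \<inter> set (q # v) = {}"
    "fst (lab p) = fst (lab q)"
  shows "disc lab (transpose p q \<circ> f) (p # u @ q # v)"
proof -
  define j where "j = fst (lab p)"
  have j: "\<And>x. x \<in> set (p # u) \<Longrightarrow> fst (lab x) = j" "\<And>x. x \<in> set (q # v) \<Longrightarrow> fst (lab x) = j"
    "label_prod lab j (p # u) = \<one>\<^bsub>A j\<^esub>" "label_prod lab j (q # v) = \<one>\<^bsub>A j\<^esub>"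
    using assms unfolding disc_def j_def by auto
  have l: "lab ` set (p # u) \<subseteq> letters" "lab ` set (q # v) \<subseteq> letters" using assms by (auto simp: disc_def)
  then have J: "j \<in> J" by (auto simp: letters_def j_def)
  interpret group "A j" by (rule is_group[OF J])
  have "label_prod lab j ((p # u) @ (q # v)) = \<one>\<^bsub>A j\<^esub>"
    using l j by (subst label_prod_append[OF J]) auto
  then show ?thesis using assms(1,2) cyclic_on_join[OF _ _ assms(3)] j l by (auto simp: disc_def)
qed

text \<open>At most one disc is lost: if \<open>p\<close> and \<open>q\<close> lie in different
  discs, these fuse into a single one; otherwise at most one disc meets \<open>{p, q}\<close> and is
  dropped. In the applications \<open>l' + 1 = l\<close>, which makes up for the loss.\<close>

lemma diagram_transpose:
  assumes dg: "diagram c lab \<sigma> \<phi> D l" and p: "p \<in> set c" and q: "q \<in> set c" and "p \<noteq> q"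
    and pq: "fst (lab p) = fst (lab q)" and l': "transp_prod l' (transpose p q \<circ> \<phi>)"
  obtains D' where "diagram c lab \<sigma> (transpose p q \<circ> \<phi>) D' l'" "card D \<le> card D' + 1"
proof -
  let ?t = "transpose p q"
  have comp: "?t \<circ> \<phi> \<circ> \<sigma> = ?t \<circ> (\<phi> \<circ> \<sigma>)" by (simp add: comp_assoc)
  have fin: "finite D" and disj: "disjoint_lists D"
    and discs: "\<And>d. d \<in> D \<Longrightarrow> set d \<subseteq> set c \<and> disc lab (\<phi> \<circ> \<sigma>) d"
    using dg by (auto simp: diagram_def)
  define K where "K = {d \<in> D. p \<notin> set d \<and> q \<notin> set d}"
  have K: "finite K" "disjoint_lists K" "K \<subseteq> D"
    using fin pairwise_subset[OF disj, of K] by (auto simp: K_def)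
  have Kd: "set d \<subseteq> set c \<and> disc lab (?t \<circ> (\<phi> \<circ> \<sigma>)) d" if "d \<in> K" for d
  proof -
    have "?t y = y" if "y \<in> set d" for y
    proof -
      have "y \<noteq> p" "y \<noteq> q" using that \<open>d \<in> K\<close> by (auto simp: K_def)
      then show ?thesis by simp
    qed
    then show ?thesis using discs disc_comp_fixing[of lab "\<phi> \<circ> \<sigma>" d ?t] \<open>d \<in> K\<close> K(3) by blast
  qed
  have dgI: "diagram c lab \<sigma> (?t \<circ> \<phi>) D' l'"
    if "finite D'" "disjoint_lists D'" "\<And>d. d \<in> D' \<Longrightarrow> set d \<subseteq> set c \<and> disc lab (?t \<circ> (\<phi> \<circ> \<sigma>)) d" for D'
  proof -
    have "fst (lab (?t y)) = fst (lab y)" for y using pq by (simp add: transpose_def)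
    moreover have "?t x = x" if "x \<notin> set c" for x using that p q by (auto simp: transpose_def)
    ultimately have "(\<forall>x. x \<notin> set c \<longrightarrow> \<sigma> x = x \<and> (?t \<circ> \<phi>) x = x)"
      "\<forall>x\<in>set c. fst (lab ((?t \<circ> (\<phi> \<circ> \<sigma>)) x)) = fst (lab x)"
      using dg unfolding diagram_def by auto
    then show ?thesis using dg l' that unfolding diagram_def comp by blast
  qed
  show thesis
  proof (cases "\<exists>d1\<in>D. \<exists>d2\<in>D. p \<in> set d1 \<and> q \<in> set d2 \<and> d1 \<noteq> d2")
    case True
    then obtain d1 d2 where d: "d1 \<in> D" "d2 \<in> D" "p \<in> set d1" "q \<in> set d2" "d1 \<noteq> d2" by blast
    then have dd: "set d1 \<inter> set d2 = {}" using disj by (auto simp: pairwise_def)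
    obtain u where u: "disc lab (\<phi> \<circ> \<sigma>) (p # u)" "set (p # u) = set d1"
      using disc_start discs d by metis
    obtain v where v: "disc lab (\<phi> \<circ> \<sigma>) (q # v)" "set (q # v) = set d2"
      using disc_start discs d by metis
    let ?d = "p # u @ q # v"
    have "set ?d = set d1 \<union> set d2" using u v by auto
    have "disc lab (?t \<circ> (\<phi> \<circ> \<sigma>)) ?d" using disc_join[OF u(1) v(1)] u v dd pq by metis
    moreover have new: "set e \<inter> set ?d = {}" if "e \<in> K" for e
    proof -
      have "e \<in> D" "e \<noteq> d1" "e \<noteq> d2" using that d by (auto simp: K_def)
      then show ?thesis using disj d unfolding \<open>set ?d = _\<close> by (auto simp: pairwise_def)
    qed
    moreover have "set ?d \<subseteq> set c" using discs[OF d(1)] discs[OF d(2)] \<open>set ?d = _\<close> by blast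
    ultimately have *: "set e \<subseteq> set c \<and> disc lab (?t \<circ> (\<phi> \<circ> \<sigma>)) e" if "e \<in> insert ?d K" for e
      using Kd that by blast
    have "disjoint_lists (insert ?d K)" by (rule disjoint_lists_insert(1)[OF K(1,2) _ new]) auto
    then have "diagram c lab \<sigma> (?t \<circ> \<phi>) (insert ?d K) l'"
      using K(1) * by (intro dgI) blast+
    moreover have "D \<subseteq> insert d1 (insert d2 K)"
      using d disjoint_lists_unique[OF disj] by (auto simp: K_def)
    then have "card D \<le> card (insert d1 (insert d2 K))" using K(1) by (intro card_mono) auto
    then have "card D \<le> card K + 2" using K(1) by (simp add: card_insert_if split: if_splits)
    moreover have "card (insert ?d K) = Suc (card K)"
      by (rule disjoint_lists_insert(2)[OF K(1,2) _ new]) auto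
    ultimately show thesis using that by simp
  next
    case False
    have "\<exists>d0. D \<subseteq> insert d0 K"
    proof (cases "D = K")
      case False
      then obtain d0 where "d0 \<in> D" "d0 \<notin> K" using K(3) by blast
      then have "p \<in> set d0 \<or> q \<in> set d0" by (auto simp: K_def)
      then have "e = d0 \<or> e \<in> K" if "e \<in> D" for e
        using that \<open>d0 \<in> D\<close> \<open>\<not> (\<exists>d1\<in>D. _ d1)\<close> disjoint_lists_unique[OF disj, of e d0]
        unfolding K_def by blast
      then show ?thesis by blast
    qed blast
    then obtain d0 where "D \<subseteq> insert d0 K" by blast
    then have "card D \<le> card (insert d0 K)" using K(1) by (intro card_mono) auto
    then have "card D \<le> card K + 1" using K(1) by (simp add: card_insert_if split: if_splits)
    then show thesis using dgI[OF K(1,2) Kd] that by blast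
  qed
qed

end

section \<open>Elementary moves on words, lifted to diagrams\<close>

lemma map_eq_appendE:
  assumes "map f c = u @ v"
  obtains cu cv where "c = cu @ cv" "map f cu = u" "map f cv = v"
  using assms by (auto simp: map_eq_append_conv)

context group_family
begin

lemma fills_mono: "fills w k \<Longrightarrow> k' \<le> k \<Longrightarrow> fills w k'"
  unfolding fills_def using order_trans by blast

lemma fillsI: "diagram (c :: nat list) lab \<sigma> \<phi> D l \<Longrightarrow> k \<le> int (card D) - int l \<Longrightarrow> fills (map lab c) k"
  unfolding fills_def by blast

lemma diagram_inj: "diagram c lab \<sigma> \<phi> D l \<Longrightarrow> inj (\<phi> \<circ> \<sigma>)"
  using transp_prod_bij bij_comp bij_is_inj unfolding diagram_def by blast

lemma diagram_phi_closed:
  assumes "diagram c lab \<sigma> \<phi> D l" "x \<in> set c"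
  shows "\<phi> x \<in> set c"
proof (rule ccontr)
  assume "\<phi> x \<notin> set c"
  then have "\<phi> (\<phi> x) = \<phi> x" using assms(1) by (auto simp: diagram_def)
  moreover have "inj \<phi>" using assms(1) transp_prod_bij bij_is_inj by (auto simp: diagram_def)
  ultimately have "\<phi> x = x" by (auto dest: injD)
  then show False using \<open>\<phi> x \<notin> set c\<close> assms(2) by simp
qed

lemma diagram_sigma_closed: "diagram c lab \<sigma> \<phi> D l \<Longrightarrow> x \<in> set c \<Longrightarrow> \<sigma> x \<in> set c"
  using cyclic_on_image by (auto simp: diagram_def)

lemma disc_singleton:
  assumes "lab e = (j, \<one>\<^bsub>A j\<^esub>)" "j \<in> J" "f e = e"
  shows "disc lab f [e]"
proof -
  interpret group "A j" by (rule is_group[OF assms(2)])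
  show ?thesis using assms by (auto simp: disc_def cyclic_on_def label_prod_def in_letters)
qed

text \<open>The identity is represented by one trivial letter rather than by the empty word, since a
  cycle is a nonempty list.\<close>

lemma fills_trivial:
  assumes "j \<in> J"
  shows "fills [(j, \<one>\<^bsub>A j\<^esub>)] 1"
proof -
  let ?lab = "\<lambda>_ :: nat. (j, \<one>\<^bsub>A j\<^esub>)"
  interpret group "A j" by (rule is_group[OF assms])
  have "diagram [0] ?lab id id {[0]} 0"
    using disc_singleton[of ?lab 0 j id] assms by (auto simp: diagram_def cyclic_on_def in_letters)
  from fillsI[OF this, of 1] show ?thesis by simp
qed

text \<open>The two new letters form a disc of length 2, which pays for the one transposition added
  to \<phi>; the old cycles of \<open>\<phi> \<circ> \<sigma>\<close> survive. A nonempty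
  \<open>u\<close> provides the letter after which to insert.\<close>

lemma fills_insert_pair:
  assumes "fills (u @ v) k" "u \<noteq> []" "j \<in> J" "x \<in> carrier (A j)"
  shows "fills (u @ (j, inv\<^bsub>A j\<^esub> x) # (j, x) # v) k"
proof -
  interpret group "A j" by (rule is_group[OF assms(3)])
  from assms(1) obtain c :: "nat list" and lab \<sigma> \<phi> D l where dg: "diagram c lab \<sigma> \<phi> D l"
    and w: "map lab c = u @ v" and k: "k \<le> int (card D) - int l" unfolding fills_def by blast
  from w obtain cu cv where c: "c = cu @ cv" and cu: "map lab cu = u" and cv: "map lab cv = v"
    by (rule map_eq_appendE)
  have "cu \<noteq> []" using cu assms(2) by auto
  obtain e where e: "e \<notin> set c" using ex_new_if_finite[of "set c"] by auto
  obtain e' where e': "e' \<notin> insert e (set c)" using ex_new_if_finite[of "insert e (set c)"] by auto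
  define x0 where "x0 = last cu"
  have x0: "x0 \<in> set c" "x0 \<noteq> e" "x0 \<noteq> e'" using \<open>cu \<noteq> []\<close> c e e' by (auto simp: x0_def)
  have \<sigma>: "cyclic_on \<sigma> c" "bij \<sigma>" "\<And>x. x \<notin> set c \<Longrightarrow> \<sigma> x = x"
    and \<phi>: "\<And>x. x \<notin> set c \<Longrightarrow> \<phi> x = x" "transp_prod l \<phi>"
    and lab: "lab ` set c \<subseteq> letters" "\<And>x. x \<in> set c \<Longrightarrow> fst (lab (\<phi> (\<sigma> x))) = fst (lab x)"
    and D: "finite D" "disjoint_lists D" "\<And>d. d \<in> D \<Longrightarrow> set d \<subseteq> set c \<and> disc lab (\<phi> \<circ> \<sigma>) d"
    using dg by (auto simp: diagram_def)
  have \<sigma>x0: "\<sigma> x0 \<in> set c" using diagram_sigma_closed[OF dg x0(1)] .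
  \<comment> \<open>In \<open>s\<close> the order is \<open>x0\<close>, \<open>e\<close>,
    \<open>e'\<close>, \<open>\<sigma> x0\<close>. The map \<open>p\<close> is chosen so that
    \<open>p \<circ> s\<close> is \<open>\<phi> \<circ> \<sigma>\<close> together with the 2-cycle
    \<open>(e e')\<close>.\<close>
  define s where "s = \<sigma> \<circ> transpose x0 e \<circ> transpose e e'"
  define p where "p = \<phi> \<circ> transpose (\<sigma> x0) e"
  define lb where "lb = lab(e := (j, inv\<^bsub>A j\<^esub> x), e' := (j, x))"
  let ?c = "cu @ e # e' # cv"
  have "\<sigma> \<circ> transpose x0 e = transpose (\<sigma> x0) e \<circ> \<sigma>"
    using comp_transpose_eq[OF \<sigma>(2), of x0 e] \<sigma>(3)[OF e] by simp
  then have ps: "(p \<circ> s) y = (\<phi> \<circ> \<sigma>) (transpose e e' y)" for y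
    by (auto simp: p_def s_def fun_eq_iff)
  have pse: "(p \<circ> s) e = e'" "(p \<circ> s) e' = e" using ps \<sigma>(3) \<phi>(1) e e' by auto
  have pso: "(p \<circ> s) y = (\<phi> \<circ> \<sigma>) y" if "y \<in> set c" for y
  proof -
    have "y \<noteq> e" "y \<noteq> e'" using that e e' by auto
    then have "transpose e e' y = y" by simp
    then show ?thesis unfolding ps by simp
  qed
  have "cyclic_on (\<sigma> \<circ> transpose x0 e) ((cu @ [e]) @ cv)"
    using cyclic_on_insert[of \<sigma> cu cv e] \<sigma> c e \<open>cu \<noteq> []\<close> by (simp add: x0_def)
  moreover have "(\<sigma> \<circ> transpose x0 e) e' = e'" using x0 e' \<sigma>(3) by auto
  ultimately have cyc: "cyclic_on s ?c"
    using cyclic_on_insert[of "\<sigma> \<circ> transpose x0 e" "cu @ [e]" cv e'] c e' by (simp add: s_def)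
  have "disc lb (p \<circ> s) [e, e']"
    using pse e' assms(3,4) by (auto simp: disc_def cyclic_on_def label_prod_def lb_def in_letters)
  moreover have od: "set d \<subseteq> set c \<and> disc lb (p \<circ> s) d" if "d \<in> D" for d
  proof -
    have "set d \<subseteq> set c" "disc lab (\<phi> \<circ> \<sigma>) d" using D(3)[OF that] by auto
    moreover have "lb y = lab y" if "y \<in> set c" for y using that e e' by (auto simp: lb_def)
    ultimately show ?thesis using disc_cong[of lab "\<phi> \<circ> \<sigma>" d lb "p \<circ> s"] pso by blast
  qed
  moreover have new: "set d \<inter> set [e, e'] = {}" if "d \<in> D" for d using od[OF that] e e' by auto
  moreover have "bij s" unfolding s_def by (intro bij_comp) (auto simp: \<sigma>)
  moreover have "transp_prod (Suc l) p" unfolding p_def by (rule transp_prod_right[OF \<phi>(2)])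
  moreover have "s y = y \<and> p y = y" if "y \<notin> set ?c" for y
  proof -
    have "y \<noteq> e" "y \<noteq> e'" "y \<notin> set c" "y \<noteq> x0" "y \<noteq> \<sigma> x0" using that c x0(1) \<sigma>x0 by auto
    then show ?thesis using \<sigma>(3) \<phi>(1) by (simp add: s_def p_def)
  qed
  moreover have "lb ` set ?c \<subseteq> letters" using lab(1) assms(3,4) c by (auto simp: lb_def in_letters)
  moreover have "fst (lb ((p \<circ> s) y)) = fst (lb y)" if "y \<in> set ?c" for y
  proof (cases "y \<in> set c")
    case True
    then have "\<phi> (\<sigma> y) \<in> set c" using diagram_sigma_closed[OF dg] diagram_phi_closed[OF dg] by blast
    then have "\<phi> (\<sigma> y) \<noteq> e" "\<phi> (\<sigma> y) \<noteq> e'" "y \<noteq> e" "y \<noteq> e'" using e e' True by auto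
    then show ?thesis using pso[OF True] lab(2)[OF True] by (simp add: lb_def)
  next
    case False
    then show ?thesis using that c pse by (auto simp: lb_def)
  qed
  ultimately have new_dg: "diagram ?c lb s p (insert [e, e'] D) (Suc l)"
    unfolding diagram_def using D(1,2) disjoint_lists_insert(1)[OF D(1,2) _ new] cyc c by auto
  have "card (insert [e, e'] D) = Suc (card D)"
    by (rule disjoint_lists_insert(2)[OF D(1,2) _ new]) auto
  then have "fills (map lb ?c) k" using k by (intro fillsI[OF new_dg]) simp
  moreover have "map lb ?c = u @ (j, inv\<^bsub>A j\<^esub> x) # (j, x) # v"
  proof -
    have "map lb cu = map lab cu" "map lb cv = map lab cv" using e e' c by (auto simp: lb_def)
    then show ?thesis using e' by (simp add: cu cv) (simp add: lb_def)
  qed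
  ultimately show ?thesis by simp
qed

text \<open>The two transpositions that change \<sigma> are undone on the right of \<phi>. Thus
  \<open>\<phi> \<circ> \<sigma>\<close> and all discs stay the same and only the length of \<phi>
  grows, by 2.\<close>

lemma fills_swap:
  assumes "fills (u @ p @ q @ v) k" "u \<noteq> []"
  shows "fills (u @ q @ p @ v) (k - 2)"
proof (cases "p = [] \<or> q = []")
  case True
  then show ?thesis using fills_mono[OF assms(1)] by auto
next
  case False
  from assms(1) obtain c :: "nat list" and lab \<sigma> \<phi> D l where dg: "diagram c lab \<sigma> \<phi> D l"
    and w: "map lab c = u @ p @ q @ v" and k: "k \<le> int (card D) - int l" unfolding fills_def by blast
  from w obtain cu c1 where c1: "c = cu @ c1" "map lab cu = u" "map lab c1 = p @ q @ v"
    by (rule map_eq_appendE)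
  from c1(3) obtain cp c2 where c2: "c1 = cp @ c2" "map lab cp = p" "map lab c2 = q @ v"
    by (rule map_eq_appendE)
  from c2(3) obtain cq cv where c3: "c2 = cq @ cv" "map lab cq = q" "map lab cv = v"
    by (rule map_eq_appendE)
  note m = c1(2) c2(2) c3(2,3)
  have c: "c = cu @ cp @ cq @ cv" using c1 c2 c3 by simp
  from False m obtain a ps b qs where ab: "cp = a # ps" "cq = b # qs" by (cases cp; cases cq) auto
  \<comment> \<open>The letter \<open>r\<close> after the second block exists because the word is
    cyclic: if \<open>cv\<close> is empty, it is the first letter of \<open>cu\<close>.\<close>
  have "cv @ cu \<noteq> []" using m assms(2) by auto
  then obtain r rs where r: "cv @ cu = r # rs" by (cases "cv @ cu") auto
  have \<sigma>: "cyclic_on \<sigma> c" "bij \<sigma>" using dg by (auto simp: diagram_def)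
  define s where "s = transpose a b \<circ> transpose b r \<circ> \<sigma>"
  define f where "f = \<phi> \<circ> transpose b r \<circ> transpose a b"
  have fs: "f \<circ> s = \<phi> \<circ> \<sigma>" by (auto simp: f_def s_def fun_eq_iff)
  have "cyclic_on \<sigma> (a # ps @ b # qs @ r # rs)"
    using cyclic_on_rotate[of \<sigma> cu "cp @ cq @ cv"] \<sigma>(1) by (simp add: c ab r)
  then have "cyclic_on s (b # qs @ a # ps @ r # rs)" unfolding s_def by (rule cyclic_on_swap)
  then have cyc: "cyclic_on s (cu @ cq @ cp @ cv)"
    using cyclic_on_rotate[of s "cq @ cp @ cv" cu] by (simp add: ab r)
  have set: "set (cu @ cq @ cp @ cv) = set c" by (auto simp: c)
  have inc: "a \<in> set c" "b \<in> set c" "r \<in> set c"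
    using ab r c by (auto, metis Un_iff list.set_intros(1) set_append)
  have "bij s" unfolding s_def by (intro bij_comp) (auto simp: \<sigma>)
  moreover have "transp_prod (l + 2) f"
  proof -
    have "transp_prod l \<phi>" using dg by (simp add: diagram_def)
    from transp_prod_right[OF transp_prod_right[OF this]] show ?thesis
      unfolding f_def add_2_eq_Suc' .
  qed
  moreover have "s y = y \<and> f y = y" if "y \<notin> set c" for y
  proof -
    have "y \<noteq> a" "y \<noteq> b" "y \<noteq> r" using that inc by auto
    then show ?thesis using dg that by (simp add: s_def f_def diagram_def)
  qed
  ultimately have new_dg: "diagram (cu @ cq @ cp @ cv) lab s f D (l + 2)"
    using dg cyc unfolding diagram_def set fs by auto
  have "fills (map lab (cu @ cq @ cp @ cv)) (k - 2)" using k by (intro fillsI[OF new_dg]) simp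
  then show ?thesis by (simp add: m)
qed

text \<open>A trivial letter can be made a disc of its own for free. If it lies in a disc, the rest
  of that disc still has trivial product, so one disc becomes two; otherwise \<open>[e]\<close> is
  an additional disc. Either gain pays for the new transposition.\<close>

lemma diagram_isolate:
  assumes dg: "diagram c lab \<sigma> \<phi> D l" and e: "e \<in> set c" and le: "lab e = (j, \<one>\<^bsub>A j\<^esub>)"
  obtains \<phi>' D' l' where "diagram c lab \<sigma> \<phi>' D' l'" "\<phi>' (\<sigma> e) = e"
    "int (card D) - int l \<le> int (card D') - int l'"
proof (cases "\<phi> (\<sigma> e) = e")
  case True
  then show ?thesis using that dg by blast
next
  case False
  let ?f = "\<phi> \<circ> \<sigma>"
  let ?t = "transpose e (?f e)"
  have inj: "inj ?f" by (rule diagram_inj[OF dg])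
  have fe: "?f e \<in> set c" using diagram_phi_closed[OF dg] diagram_sigma_closed[OF dg] e by simp
  have jJ: "j \<in> J" using dg e le by (force simp: diagram_def in_letters)
  interpret group "A j" by (rule is_group[OF jJ])
  have fin: "finite D" and disj: "disjoint_lists D"
    and discs: "\<And>d. d \<in> D \<Longrightarrow> set d \<subseteq> set c \<and> disc lab ?f d"
    using dg by (auto simp: diagram_def)
  have feq: "fst (lab (?f e)) = fst (lab e)" using dg e by (simp add: diagram_def)
  have comp: "?t \<circ> \<phi> \<circ> \<sigma> = ?t \<circ> ?f" by (simp add: comp_assoc)
  have dgI: "diagram c lab \<sigma> (?t \<circ> \<phi>) D' (Suc l)"
    if "finite D'" "disjoint_lists D'" "\<And>d. d \<in> D' \<Longrightarrow> set d \<subseteq> set c \<and> disc lab (?t \<circ> ?f) d" for D'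
  proof -
    have "fst (lab (?t y)) = fst (lab y)" for y using feq by (auto simp: transpose_def)
    moreover have "?t x = x" if "x \<notin> set c" for x
    proof -
      have "x \<noteq> e" "x \<noteq> ?f e" using that e fe by auto
      then show ?thesis by simp
    qed
    ultimately have "(\<forall>x. x \<notin> set c \<longrightarrow> \<sigma> x = x \<and> (?t \<circ> \<phi>) x = x)"
      "\<forall>x\<in>set c. fst (lab ((?t \<circ> ?f) x)) = fst (lab x)"
      using dg unfolding diagram_def by auto
    moreover have "transp_prod (Suc l) (?t \<circ> \<phi>)"
      by (rule transp_prod_step) (use dg in \<open>simp add: diagram_def\<close>)
    ultimately show ?thesis using dg that unfolding diagram_def comp by blast
  qed
  have se: "disc lab (?t \<circ> ?f) [e]" using disc_singleton[of lab e j "?t \<circ> ?f"] le jJ by simp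
  have other: "set d \<subseteq> set c \<and> disc lab (?t \<circ> ?f) d" if "d \<in> D" "e \<notin> set d" for d
  proof -
    have "?f e \<notin> set d" using cyclic_on_preimage[of ?f d e] discs[OF that(1)] inj that(2)
      by (auto simp: disc_def)
    then have "?t y = y" if "y \<in> set d" for y
      using that \<open>e \<notin> set d\<close> by (metis transpose_apply_other)
    then show ?thesis using discs[OF that(1)] disc_comp_fixing[of lab ?f d ?t] by blast
  qed
  have te: "(?t \<circ> \<phi>) (\<sigma> e) = e" by simp
  show ?thesis
  proof (cases "\<exists>d\<in>D. e \<in> set d")
    case True
    then obtain d where d: "d \<in> D" "e \<in> set d" by blast
    obtain r where r: "disc lab ?f (e # r)" "set (e # r) = set d" "e \<notin> set r"
      using disc_start discs d by metis
    have "r \<noteq> []"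
    proof
      assume "r = []"
      with r(1) show False using False by (simp add: disc_def cyclic_on_def)
    qed
    have er: "disc lab (?t \<circ> ?f) r"
    proof -
      obtain i where i: "\<forall>x\<in>set (e # r). fst (lab x) = i" "label_prod lab i (e # r) = \<one>\<^bsub>A i\<^esub>"
        and lr: "lab ` set (e # r) \<subseteq> letters" using r(1) by (auto simp: disc_def)
      have "i = j" using i(1) le by simp
      have cl: "label_prod lab j r \<in> carrier (A j)"
        using i(1) lr jJ \<open>i = j\<close> by (intro label_prod_closed) auto
      have "label_prod lab j r = \<one>\<^bsub>A j\<^esub>"
        using i(2) cl le \<open>i = j\<close> by (simp add: label_prod_Cons)
      moreover have "cyclic_on (?t \<circ> ?f) r"
        using r(1) unfolding disc_def by (intro cyclic_on_skip[OF _ \<open>r \<noteq> []\<close>]) blast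
      ultimately show ?thesis using i(1) lr \<open>i = j\<close> unfolding disc_def by auto
    qed
    let ?K = "D - {d}"
    have Ke: "e' \<in> ?K \<Longrightarrow> set e' \<inter> set d = {}" for e' using disj d by (auto simp: pairwise_def)
    have K: "finite ?K" "disjoint_lists ?K" using fin pairwise_subset[OF disj, of ?K] by auto
    have n1: "set e' \<inter> set r = {}" if "e' \<in> ?K" for e' using Ke[OF that] r(2) by auto
    note K1 = disjoint_lists_insert[OF K \<open>r \<noteq> []\<close> n1]
    have n2: "set e' \<inter> set [e] = {}" if "e' \<in> insert r ?K" for e'
      using that Ke d(2) r(3) by auto
    have K2: "disjoint_lists (insert [e] (insert r ?K))" "card (insert [e] (insert r ?K)) = Suc (card (insert r ?K))"
      using disjoint_lists_insert[OF _ K1(1) _ n2] K(1) by auto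
    have "set d' \<subseteq> set c \<and> disc lab (?t \<circ> ?f) d'" if mem: "d' \<in> insert [e] (insert r ?K)" for d'
    proof -
      consider "d' = [e]" | "d' = r" | "d' \<in> ?K" using mem by blast
      then show ?thesis
      proof cases
        case 3
        then have "e \<notin> set d'" using Ke d(2) by blast
        then show ?thesis using other 3 by blast
      qed (use se er e r(2) discs[OF d(1)] in auto)
    qed
    then have "diagram c lab \<sigma> (?t \<circ> \<phi>) (insert [e] (insert r ?K)) (Suc l)"
      using K(1) K2(1) by (intro dgI) auto
    moreover have "card D = Suc (card ?K)" using fin d(1) by (metis card_Suc_Diff1)
    ultimately show ?thesis
      using that[of "?t \<circ> \<phi>" "insert [e] (insert r ?K)" "Suc l"] te K1(2) K2(2) by simp
  next
    case no: False
    have n2: "set e' \<inter> set [e] = {}" if "e' \<in> D" for e' using that no by auto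
    have K2: "disjoint_lists (insert [e] D)" "card (insert [e] D) = Suc (card D)"
      using disjoint_lists_insert[OF fin disj _ n2] by auto
    have "set d' \<subseteq> set c \<and> disc lab (?t \<circ> ?f) d'" if "d' \<in> insert [e] D" for d'
    proof (cases "d' = [e]")
      case True
      then show ?thesis using se e by simp
    next
      case False
      then show ?thesis using that other no by blast
    qed
    then have "diagram c lab \<sigma> (?t \<circ> \<phi>) (insert [e] D) (Suc l)"
      using fin K2(1) by (intro dgI) auto
    then show ?thesis using that[of "?t \<circ> \<phi>" "insert [e] D" "Suc l"] te K2(2) by simp
  qed
qed

text \<open>Once \<open>e\<close> is alone in its piece, taking it out of \<sigma> while keeping
  \<open>\<phi> \<circ> \<sigma>\<close> takes it out of \<phi> as well. This saves a transposition
  and costs at most the disc containing \<open>e\<close>.\<close>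

lemma fills_delete:
  assumes "fills (u @ (j, \<one>\<^bsub>A j\<^esub>) # v) k" "u @ v \<noteq> []"
  shows "fills (u @ v) k"
proof -
  from assms(1) obtain c :: "nat list" and lab \<sigma> \<phi>0 D0 l0 where dg0: "diagram c lab \<sigma> \<phi>0 D0 l0"
    and w: "map lab c = u @ (j, \<one>\<^bsub>A j\<^esub>) # v" and k0: "k \<le> int (card D0) - int l0"
    unfolding fills_def by blast
  from w obtain cu c1 where c1: "c = cu @ c1" "map lab cu = u" "map lab c1 = (j, \<one>\<^bsub>A j\<^esub>) # v"
    by (rule map_eq_appendE)
  from c1(3) obtain e cv where c2: "c1 = e # cv" "lab e = (j, \<one>\<^bsub>A j\<^esub>)" "map lab cv = v"
    by (cases c1) auto
  have c: "c = cu @ e # cv" using c1 c2 by simp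
  have ec: "e \<in> set c" by (simp add: c)
  obtain \<phi> D l where dg: "diagram c lab \<sigma> \<phi> D l" and pe: "\<phi> (\<sigma> e) = e"
    and k: "k \<le> int (card D) - int l"
    using diagram_isolate[OF dg0 ec c2(2)] k0 by (metis order_trans)
  have \<sigma>: "cyclic_on \<sigma> c" "bij \<sigma>" using dg by (auto simp: diagram_def)
  have r: "cv @ cu \<noteq> []" using assms(2) c1(2) c2(3) by auto
  have rot: "cyclic_on \<sigma> (e # cv @ cu)" using cyclic_on_rotate[of \<sigma> cu "e # cv"] \<sigma>(1) by (simp add: c)
  then have "\<sigma> e = hd (cv @ cu)" "e \<notin> set (cv @ cu)" using r by (auto simp: cyclic_on_def successively_Cons)
  \<comment> \<open>A second letter exists, so \<open>e\<close> is moved by \<sigma>, and then by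
    \<phi> because \<open>\<phi> (\<sigma> e) = e\<close>. Hence removing \<open>e\<close> really
    shortens \<phi>.\<close>
  then have "\<sigma> e \<noteq> e" using hd_in_set[OF r] by metis
  have "bij \<phi>" using dg transp_prod_bij by (auto simp: diagram_def)
  then have "\<phi> e \<noteq> e" using \<open>\<sigma> e \<noteq> e\<close> pe by (metis bij_is_inj injD)
  have "transp_prod l \<phi>" using dg by (simp add: diagram_def)
  from transp_prod_skip[OF this \<open>\<phi> e \<noteq> e\<close>] obtain l' where l': "l = Suc l'"
    "transp_prod l' (transpose e (\<phi> e) \<circ> \<phi>)" by blast
  define s where "s = transpose e (\<sigma> e) \<circ> \<sigma>"
  define p where "p = \<phi> \<circ> transpose e (\<sigma> e)"
  have ps: "p \<circ> s = \<phi> \<circ> \<sigma>" by (auto simp: p_def s_def fun_eq_iff)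
  have "p = transpose e (\<phi> e) \<circ> \<phi>"
    unfolding p_def using comp_transpose_eq[OF \<open>bij \<phi>\<close>, of e "\<sigma> e"] by (simp add: pe transpose_commute)
  then have tp: "transp_prod l' p" using l' by simp
  have "cyclic_on s (cv @ cu)" unfolding s_def by (rule cyclic_on_skip[OF rot r])
  then have cyc: "cyclic_on s (cu @ cv)" by (rule cyclic_on_rotate)
  have "bij s" unfolding s_def by (intro bij_comp) (auto simp: \<sigma>)
  have out: "s y = y \<and> p y = y" if "y \<notin> set (cu @ cv)" for y
  proof (cases "y = e")
    case True
    then show ?thesis by (simp add: s_def p_def pe)
  next
    case False
    then have "y \<notin> set c" using that c by auto
    then have "y \<noteq> \<sigma> e" using diagram_sigma_closed[OF dg ec] by auto
    then show ?thesis using False \<open>y \<notin> set c\<close> dg by (simp add: s_def p_def diagram_def)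
  qed
  define D' where "D' = {d \<in> D. e \<notin> set d}"
  have fin: "finite D" and disj: "disjoint_lists D"
    and discs: "\<And>d. d \<in> D \<Longrightarrow> set d \<subseteq> set c \<and> disc lab (\<phi> \<circ> \<sigma>) d"
    using dg by (auto simp: diagram_def)
  have D': "finite D'" "disjoint_lists D'" using fin pairwise_subset[OF disj, of D'] by (auto simp: D'_def)
  have "set d \<subseteq> set (cu @ cv) \<and> disc lab (\<phi> \<circ> \<sigma>) d" if "d \<in> D'" for d
    using discs[of d] that unfolding D'_def c by auto
  moreover have "lab ` set (cu @ cv) \<subseteq> letters" using dg by (auto simp: diagram_def c)
  moreover have "\<forall>x\<in>set (cu @ cv). fst (lab ((\<phi> \<circ> \<sigma>) x)) = fst (lab x)" using dg by (auto simp: diagram_def c)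
  ultimately have new_dg: "diagram (cu @ cv) lab s p D' l'"
    unfolding diagram_def ps using cyc \<open>bij s\<close> out tp D' by blast
  have "card D \<le> card D' + 1"
  proof (cases "\<exists>d\<in>D. e \<in> set d")
    case True
    then obtain d where "d \<in> D" "e \<in> set d" by blast
    then have "D \<subseteq> insert d D'" using disjoint_lists_unique[OF disj] by (auto simp: D'_def)
    then have "card D \<le> card (insert d D')" using D'(1) by (intro card_mono) auto
    then show ?thesis using D'(1) by (simp add: card_insert_if split: if_splits)
  next
    case False
    then have "D = D'" by (auto simp: D'_def)
    then show ?thesis by simp
  qed
  then have "fills (map lab (cu @ cv)) k" using k l'(1) by (intro fillsI[OF new_dg]) simp
  then show ?thesis using c1(2) c2(3) by simp
qed

text \<open>When the next letter belongs to the same factor, it may be assumed to follow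
  \<open>i\<close> in its piece too: cutting \<open>\<sigma> i\<close> out of \<phi> saves a
  transposition and destroys at most one disc.\<close>

lemma diagram_link:
  assumes dg: "diagram c lab \<sigma> \<phi> D l" and i: "i \<in> set c" and same: "fst (lab (\<sigma> i)) = fst (lab i)"
  obtains \<phi>' D' l' where "diagram c lab \<sigma> \<phi>' D' l'" "\<phi>' (\<sigma> i) = \<sigma> i"
    "int (card D) - int l \<le> int (card D') - int l'"
proof (cases "\<phi> (\<sigma> i) = \<sigma> i")
  case True
  then show ?thesis using that dg by blast
next
  case False
  have "transp_prod l \<phi>" using dg by (simp add: diagram_def)
  from transp_prod_skip[OF this False] obtain l' where l': "l = Suc l'"
    "transp_prod l' (transpose (\<sigma> i) (\<phi> (\<sigma> i)) \<circ> \<phi>)" by blast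
  have "\<sigma> i \<in> set c" using diagram_sigma_closed[OF dg i] .
  moreover from this have "\<phi> (\<sigma> i) \<in> set c" by (rule diagram_phi_closed[OF dg])
  moreover have "fst (lab (\<sigma> i)) = fst (lab (\<phi> (\<sigma> i)))" using dg i same by (simp add: diagram_def)
  ultimately obtain D' where "diagram c lab \<sigma> (transpose (\<sigma> i) (\<phi> (\<sigma> i)) \<circ> \<phi>) D' l'" "card D \<le> card D' + 1"
    using diagram_transpose[OF dg _ _ False[symmetric] _ l'(2)] by blast
  then show ?thesis using that[of "transpose (\<sigma> i) (\<phi> (\<sigma> i)) \<circ> \<phi>" D' l'] l'(1) by simp
qed

text \<open>After \<open>diagram_link\<close> the two letters are neighbours both in the word and in
  their piece, and \<phi> fixes the second. Fusing them changes neither the length of \<phi>, nor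
  the number of discs, nor any boundary product.\<close>

lemma fills_merge:
  assumes "fills (u @ (j, x) # (j, y) # v) k"
  shows "fills (u @ (j, x \<otimes>\<^bsub>A j\<^esub> y) # v) k"
proof -
  from assms(1) obtain c :: "nat list" and lab \<sigma> \<phi>0 D0 l0 where dg0: "diagram c lab \<sigma> \<phi>0 D0 l0"
    and w: "map lab c = u @ (j, x) # (j, y) # v" and k0: "k \<le> int (card D0) - int l0"
    unfolding fills_def by blast
  from w obtain cu c1 where c1: "c = cu @ c1" "map lab cu = u" "map lab c1 = (j, x) # (j, y) # v"
    by (rule map_eq_appendE)
  from c1(3) obtain i i' cv where c2: "c1 = i # i' # cv" "lab i = (j, x)" "lab i' = (j, y)" "map lab cv = v"
    by (auto simp: map_eq_Cons_conv)
  have c: "c = cu @ i # i' # cv" using c1 c2 by simp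
  have ic: "i \<in> set c" "i' \<in> set c" by (simp_all add: c)
  have cyc0: "cyclic_on \<sigma> c" using dg0 by (simp add: diagram_def)
  then have si: "\<sigma> i = i'" and ii: "i \<noteq> i'" and dc: "distinct c"
    by (auto simp: c cyclic_on_def successively_append_iff)
  have same: "fst (lab (\<sigma> i)) = fst (lab i)" using c2 si by simp
  obtain \<phi> D l where dg: "diagram c lab \<sigma> \<phi> D l" and pi: "\<phi> i' = i'"
    and k: "k \<le> int (card D) - int l"
    using diagram_link[OF dg0 ic(1) same] k0 unfolding si by (metis order_trans)
  let ?f = "\<phi> \<circ> \<sigma>"
  have inj: "inj ?f" by (rule diagram_inj[OF dg])
  have fi: "?f i = i'" using si pi by simp
  have \<sigma>: "bij \<sigma>" using dg by (auto simp: diagram_def)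
  have "bij \<phi>" using dg transp_prod_bij by (auto simp: diagram_def)
  define s where "s = transpose i' (\<sigma> i') \<circ> \<sigma>"
  define lb where "lb = lab(i := (j, x \<otimes>\<^bsub>A j\<^esub> y))"
  let ?t = "transpose i' (?f i')"
  have "\<phi> \<circ> transpose i' (\<sigma> i') = ?t \<circ> \<phi>"
    using comp_transpose_eq[OF \<open>bij \<phi>\<close>, of i' "\<sigma> i'"] by (simp add: pi)
  then have ps: "\<phi> \<circ> s = ?t \<circ> ?f" by (simp add: s_def comp_assoc[symmetric])
  have labl: "lab ` set c \<subseteq> letters" using dg by (simp add: diagram_def)
  then have jJ: "j \<in> J" and xy: "x \<in> carrier (A j)" "y \<in> carrier (A j)"
    using ic c2(2,3) by (force simp: in_letters)+
  interpret group "A j" by (rule is_group[OF jJ])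
  have "cyclic_on \<sigma> (i' # cv @ cu @ [i])" using cyclic_on_rotate[of \<sigma> "cu @ [i]" "i' # cv"] cyc0 by (simp add: c)
  from cyclic_on_skip[OF this] have "cyclic_on s (cv @ cu @ [i])" by (simp add: s_def)
  then have cyc: "cyclic_on s (cu @ i # cv)" using cyclic_on_rotate[of s cv "cu @ [i]"] by simp
  have "bij s" unfolding s_def by (intro bij_comp) (auto simp: \<sigma>)
  have setc: "set c = insert i' (set (cu @ i # cv))" and i'n: "i' \<notin> set (cu @ i # cv)"
    using dc by (auto simp: c)
  have out: "s z = z \<and> \<phi> z = z" if "z \<notin> set (cu @ i # cv)" for z
  proof (cases "z = i'")
    case True
    then show ?thesis by (simp add: s_def pi)
  next
    case False
    then have "z \<notin> set c" using that setc by auto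
    then have "z \<noteq> \<sigma> i'" using diagram_sigma_closed[OF dg ic(2)] by auto
    then show ?thesis using False \<open>z \<notin> set c\<close> dg by (simp add: s_def diagram_def)
  qed
  have fl: "fst (lb z) = fst (lab z)" for z using c2(2) by (simp add: lb_def)
  have "fst (lab (?t z)) = fst (lab z)" for z
    using dg ic(2) by (auto simp: transpose_def diagram_def)
  then have fac: "\<forall>z\<in>set (cu @ i # cv). fst (lb ((?t \<circ> ?f) z)) = fst (lb z)"
    using dg unfolding fl by (auto simp: diagram_def c)
  have ll: "lb ` set (cu @ i # cv) \<subseteq> letters"
    using labl xy jJ by (auto simp: lb_def in_letters setc)
  have fin: "finite D" and disj: "disjoint_lists D"
    and discs: "\<And>d. d \<in> D \<Longrightarrow> set d \<subseteq> set c \<and> disc lab ?f d"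
    using dg by (auto simp: diagram_def)
  have other: "set d \<subseteq> set (cu @ i # cv) \<and> disc lb (?t \<circ> ?f) d" if "d \<in> D" "i \<notin> set d" for d
  proof -
    have cd: "cyclic_on ?f d" using discs[OF that(1)] by (simp add: disc_def)
    have "i' \<notin> set d" using cyclic_on_preimage[OF cd _ inj, of i] that(2) fi by auto
    moreover from this have "?f i' \<notin> set d" using cyclic_on_preimage[OF cd _ inj, of i'] by auto
    ultimately have "?t z = z" if "z \<in> set d" for z using that by (metis transpose_apply_other)
    then have "disc lab (?t \<circ> ?f) d" using discs[OF that(1)] disc_comp_fixing[of lab ?f d ?t] by blast
    moreover have "lb z = lab z" if "z \<in> set d" for z using that \<open>i \<notin> set d\<close> by (auto simp: lb_def)
    ultimately have "disc lb (?t \<circ> ?f) d" by (rule disc_cong) auto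
    then show ?thesis using discs[OF that(1)] setc \<open>i' \<notin> set d\<close> by auto
  qed
  \<comment> \<open>A disc contains both \<open>i\<close> and \<open>i'\<close> or neither. In the
    first case it reads \<open>i # i' # q\<close> up to rotation and is replaced by
    \<open>i # q\<close>.\<close>
  obtain D' where D': "finite D'" "disjoint_lists D'" "card D' = card D"
    "\<And>d. d \<in> D' \<Longrightarrow> set d \<subseteq> set (cu @ i # cv) \<and> disc lb (?t \<circ> ?f) d"
  proof (cases "\<exists>d\<in>D. i \<in> set d")
    case False
    then show thesis using that[OF fin disj refl] other by blast
  next
    case True
    then obtain d where d: "d \<in> D" "i \<in> set d" by blast
    obtain r where r: "disc lab ?f (i # r)" "set (i # r) = set d" "i \<notin> set r"
      using disc_start discs d by metis
    have cr: "cyclic_on ?f (i # r)" using r(1) by (simp only: disc_def)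
    have "r \<noteq> []"
    proof
      assume "r = []"
      with cr fi ii show False by (simp add: cyclic_on_def)
    qed
    with cr fi obtain q where q: "r = i' # q" by (cases r) (auto simp: cyclic_on_def)
    have "cyclic_on ?f (i' # q @ [i])" using cyclic_on_rotate[of ?f "[i]" "i' # q"] cr by (simp add: q)
    from cyclic_on_skip[OF this] have "cyclic_on (?t \<circ> ?f) (q @ [i])" by simp
    then have cq: "cyclic_on (?t \<circ> ?f) (i # q)" using cyclic_on_rotate[of "?t \<circ> ?f" q "[i]"] by simp
    obtain h where h: "\<forall>z\<in>set (i # r). fst (lab z) = h" "label_prod lab h (i # r) = \<one>\<^bsub>A h\<^esub>"
      and lr: "lab ` set (i # r) \<subseteq> letters" using r(1) unfolding disc_def by blast
    have hj: "h = j" using h(1) c2(2) by simp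
    have cl: "label_prod lab j q \<in> carrier (A j)"
      using h(1) lr jJ hj q by (intro label_prod_closed) auto
    have iq: "i \<notin> set q" "i' \<notin> set q" using cr q by (auto simp: cyclic_on_def)
    have "label_prod lb j q = label_prod lab j q" by (rule label_prod_cong) (use iq in \<open>auto simp: lb_def\<close>)
    then have "label_prod lb j (i # q) = label_prod lab j (i # r)"
      using cl xy by (simp add: label_prod_Cons q c2 lb_def m_assoc)
    then have pr: "label_prod lb j (i # q) = \<one>\<^bsub>A j\<^esub>" using h(2) hj by simp
    have sub: "set (i # q) \<subseteq> set (cu @ i # cv)"
      using discs[OF d(1)] r(2) iq(2) ii unfolding setc q by auto
    have "\<forall>z\<in>set (i # q). fst (lb z) = j" unfolding fl using h(1) hj q by auto
    then have dq: "disc lb (?t \<circ> ?f) (i # q)"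
      using cq pr sub ll unfolding disc_def by blast
    let ?K = "D - {d}"
    have Ke: "e' \<in> ?K \<Longrightarrow> set e' \<inter> set d = {}" for e' using disj d by (auto simp: pairwise_def)
    have K: "finite ?K" "disjoint_lists ?K" using fin pairwise_subset[OF disj, of ?K] by auto
    have n1: "set e' \<inter> set (i # q) = {}" if "e' \<in> ?K" for e' using Ke[OF that] r(2) q by auto
    have K1: "disjoint_lists (insert (i # q) ?K)" "card (insert (i # q) ?K) = Suc (card ?K)"
      by (rule disjoint_lists_insert[OF K _ n1]; simp)+
    have "set d' \<subseteq> set (cu @ i # cv) \<and> disc lb (?t \<circ> ?f) d'" if "d' \<in> insert (i # q) ?K" for d'
    proof (cases "d' = i # q")
      case True
      then show ?thesis using dq sub by blast
    next
      case False
      then have "d' \<in> ?K" using that by blast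
      then show ?thesis using other Ke d(2) by blast
    qed
    moreover have "card (insert (i # q) ?K) = card D" using K1(2) fin d(1) by (metis card_Suc_Diff1)
    moreover have "finite (insert (i # q) ?K)" using K(1) by simp
    ultimately show thesis using that K1(1) by blast
  qed
  have "transp_prod l \<phi>" using dg by (simp add: diagram_def)
  then have new_dg: "diagram (cu @ i # cv) lb s \<phi> D' l"
    unfolding diagram_def ps using cyc \<open>bij s\<close> out ll fac D' by blast
  have "fills (map lb (cu @ i # cv)) k" using k D'(3) by (intro fillsI[OF new_dg]) simp
  moreover have "map lb cu = map lab cu" "map lb cv = map lab cv" using dc by (auto simp: lb_def c)
  ultimately show ?thesis using c1(2) c2(4) by (simp add: lb_def)
qed

end

subsection \<open>The free product and its commutators\<close>

context group_family
begin

text \<open>Every reduced word has the form \<open>fp_cons j z w'\<close> with \<open>z\<close> in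
  factor \<open>j\<close>, possibly trivial, and \<open>w'\<close> not starting in \<open>j\<close>.
  On this form \<open>fp_push\<close> just multiplies \<open>z\<close>, which hides the case
  distinctions of the reduction.\<close>

definition fp_cons :: "'j \<Rightarrow> 'a \<Rightarrow> ('j \<times> 'a) list \<Rightarrow> ('j \<times> 'a) list" where
  "fp_cons j x w = (if x = \<one>\<^bsub>A j\<^esub> then w else (j, x) # w)"

definition word_inv :: "('j \<times> 'a) list \<Rightarrow> ('j \<times> 'a) list" where
  "word_inv w = rev (map (\<lambda>(j, x). (j, inv\<^bsub>A j\<^esub> x)) w)"

abbreviation reduced :: "('j \<times> 'a) list \<Rightarrow> bool" where
  "reduced \<equiv> reduced_word A J"

lemma reduced_Cons:
  "reduced ((j, x) # w) \<longleftrightarrow> (j, x) \<in> letters \<and> x \<noteq> \<one>\<^bsub>A j\<^esub> \<and> reduced w \<and> (w = [] \<or> fst (hd w) \<noteq> j)"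
  by (cases w) (auto simp: reduced_word_def in_letters)

lemma reduced_Nil: "reduced []"
  by (simp add: reduced_word_def)

lemma reduced_letters: "reduced w \<Longrightarrow> set w \<subseteq> letters"
  by (auto simp: reduced_word_def letters_def)

lemma fp_push_fp_cons:
  assumes "j \<in> J" "x \<in> carrier (A j)" "z \<in> carrier (A j)" "w = [] \<or> fst (hd w) \<noteq> j"
  shows "fp_push A (j, x) (fp_cons j z w) = fp_cons j (x \<otimes>\<^bsub>A j\<^esub> z) w"
proof -
  interpret group "A j" by (rule is_group[OF assms(1)])
  show ?thesis using assms by (cases w) (auto simp: fp_cons_def)
qed

lemma reduced_fp_cons:
  assumes "reduced w" "j \<in> J"
  obtains z w' where "w = fp_cons j z w'" "z \<in> carrier (A j)" "reduced w'" "w' = [] \<or> fst (hd w') \<noteq> j"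
proof (cases "w = [] \<or> fst (hd w) \<noteq> j")
  case True
  interpret group "A j" by (rule is_group[OF assms(2)])
  show ?thesis using True that[of "\<one>\<^bsub>A j\<^esub>" w] assms(1) by (auto simp: fp_cons_def)
next
  case False
  then obtain z w' where w: "w = (j, z) # w'" by (cases w) auto
  then show ?thesis using assms(1) that[of z w'] by (auto simp: fp_cons_def reduced_Cons in_letters)
qed

lemma reduced_fp_push:
  assumes "reduced w" "j \<in> J" "x \<in> carrier (A j)"
  shows "reduced (fp_push A (j, x) w)"
proof -
  interpret group "A j" by (rule is_group[OF assms(2)])
  obtain z w' where "w = fp_cons j z w'" "z \<in> carrier (A j)" "reduced w'" "w' = [] \<or> fst (hd w') \<noteq> j"
    using reduced_fp_cons[OF assms(1,2)] .
  then show ?thesis using assms fp_push_fp_cons[of j x z w'] by (auto simp: fp_cons_def reduced_Cons in_letters)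
qed

text \<open>Each factor acts on the set of reduced words, as in the proof of van der Waerden;
  associativity of the free product rests on this.\<close>

lemma fp_push_fp_push:
  assumes "reduced w" "j \<in> J" "x \<in> carrier (A j)" "y \<in> carrier (A j)"
  shows "fp_push A (j, x) (fp_push A (j, y) w) = fp_push A (j, x \<otimes>\<^bsub>A j\<^esub> y) w"
proof -
  interpret group "A j" by (rule is_group[OF assms(2)])
  obtain z w' where "w = fp_cons j z w'" "z \<in> carrier (A j)" "reduced w'" "w' = [] \<or> fst (hd w') \<noteq> j"
    using reduced_fp_cons[OF assms(1,2)] .
  then show ?thesis using assms by (simp add: fp_push_fp_cons m_assoc)
qed

lemma fp_push_one: "fp_push A (j, \<one>\<^bsub>A j\<^esub>) w = w"
  by (cases w) auto

lemma reduced_foldr_fp_push: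
  "set u \<subseteq> letters \<Longrightarrow> reduced w \<Longrightarrow> reduced (foldr (fp_push A) u w)"
  by (induction u) (auto simp: in_letters intro!: reduced_fp_push)

lemma foldr_fp_push_fp_push:
  assumes "(j, x) \<in> letters" "set v \<subseteq> letters" "reduced w"
  shows "foldr (fp_push A) (fp_push A (j, x) v) w = fp_push A (j, x) (foldr (fp_push A) v w)"
proof (cases v)
  case Nil
  then show ?thesis using fp_push_one by auto
next
  case (Cons l v')
  obtain k y where l: "l = (k, y)" by (cases l)
  have r: "reduced (foldr (fp_push A) v' w)" using assms Cons by (intro reduced_foldr_fp_push) auto
  have "(k, y) \<in> letters" using assms Cons l by simp
  then show ?thesis using assms fp_push_fp_push[OF r, of k x y] fp_push_one[of k]
    by (auto simp: Cons l in_letters fp_push_one)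
qed

lemma foldr_fp_push_assoc:
  "set u \<subseteq> letters \<Longrightarrow> reduced v \<Longrightarrow> reduced w \<Longrightarrow>
    foldr (fp_push A) (foldr (fp_push A) u v) w = foldr (fp_push A) u (foldr (fp_push A) v w)"
proof (induction u)
  case (Cons l u)
  obtain k y where l: "l = (k, y)" by (cases l)
  have "reduced (foldr (fp_push A) u v)" using Cons.prems by (intro reduced_foldr_fp_push) auto
  then show ?case using Cons foldr_fp_push_fp_push[of k y] reduced_letters l by simp
qed simp

lemma word_inv_Cons: "word_inv ((j, x) # w) = word_inv w @ [(j, inv\<^bsub>A j\<^esub> x)]"
  by (simp add: word_inv_def)

lemma reduced_word_inv:
  assumes "reduced w"
  shows "reduced (word_inv w)"
proof -
  have "(j, inv\<^bsub>A j\<^esub> x) \<in> letters \<and> inv\<^bsub>A j\<^esub> x \<noteq> \<one>\<^bsub>A j\<^esub>" if "(j, x) \<in> set w" for j x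
  proof -
    have *: "j \<in> J" "x \<in> carrier (A j)" "x \<noteq> \<one>\<^bsub>A j\<^esub>" using assms that by (auto simp: reduced_word_def)
    interpret group "A j" by (rule is_group[OF *(1)])
    show ?thesis using * by (auto simp: in_letters)
  qed
  moreover have "successively (\<lambda>p q. fst p \<noteq> fst q) (word_inv w)"
    using assms unfolding word_inv_def reduced_word_def
    by (auto simp: successively_map case_prod_beta eq_commute)
  ultimately show ?thesis unfolding reduced_word_def word_inv_def by (auto simp: in_letters)
qed

lemma foldr_fp_push_word_inv:
  "reduced w \<Longrightarrow> foldr (fp_push A) (word_inv w) w = []"
proof (induction w)
  case Nil
  then show ?case by (simp add: word_inv_def)
next
  case (Cons l w)
  obtain k y where l: "l = (k, y)" by (cases l)
  have *: "k \<in> J" "y \<in> carrier (A k)" "y \<noteq> \<one>\<^bsub>A k\<^esub>" "reduced w" using Cons.prems by (auto simp: l reduced_Cons in_letters)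
  interpret group "A k" by (rule is_group[OF *(1)])
  have "fp_push A (k, inv\<^bsub>A k\<^esub> y) ((k, y) # w) = w" using * by auto
  then show ?case using Cons.IH * by (simp add: l word_inv_Cons)
qed

lemma free_product_simps:
  "carrier (free_product A J) = {w. reduced w}" "\<one>\<^bsub>free_product A J\<^esub> = []"
  "u \<otimes>\<^bsub>free_product A J\<^esub> v = foldr (fp_push A) u v"
  by (simp_all add: free_product_def)

lemma free_product_group: "group (free_product A J)"
proof (rule groupI)
  fix x y z
  assume "x \<in> carrier (free_product A J)" "y \<in> carrier (free_product A J)" "z \<in> carrier (free_product A J)"
  then show "x \<otimes>\<^bsub>free_product A J\<^esub> y \<otimes>\<^bsub>free_product A J\<^esub> z = x \<otimes>\<^bsub>free_product A J\<^esub> (y \<otimes>\<^bsub>free_product A J\<^esub> z)"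
    using foldr_fp_push_assoc reduced_letters by (simp add: free_product_simps)
next
  fix x assume "x \<in> carrier (free_product A J)"
  then show "\<exists>y\<in>carrier (free_product A J). y \<otimes>\<^bsub>free_product A J\<^esub> x = \<one>\<^bsub>free_product A J\<^esub>"
    using reduced_word_inv foldr_fp_push_word_inv by (auto simp: free_product_simps)
qed (simp_all add: free_product_simps reduced_Nil reduced_letters reduced_foldr_fp_push)

lemma free_product_inv:
  "reduced w \<Longrightarrow> inv\<^bsub>free_product A J\<^esub> w = word_inv w"
  using group.inv_equality[OF free_product_group, of "word_inv w" w] reduced_word_inv foldr_fp_push_word_inv
  by (simp add: free_product_simps)

section \<open>Fillings of products of commutators\<close>

lemma fills_fp_push:
  assumes "fills (u @ (j, x) # w) k" "u \<noteq> []"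
  shows "fills (u @ fp_push A (j, x) w) k"
proof (cases "x = \<one>\<^bsub>A j\<^esub>")
  case True
  then show ?thesis using fills_delete[of u j w k] assms by (simp add: fp_push_one)
next
  case x: False
  show ?thesis
  proof (cases "w = [] \<or> fst (hd w) \<noteq> j")
    case True
    then show ?thesis using assms x by (cases w) auto
  next
    case False
    then obtain y w' where w: "w = (j, y) # w'" by (cases w) auto
    have m: "fills (u @ (j, x \<otimes>\<^bsub>A j\<^esub> y) # w') k" using fills_merge assms(1) by (simp add: w)
    then show ?thesis using x fills_delete[of u j w' k] assms(2) by (auto simp: w)
  qed
qed

text \<open>Reduction is a sequence of merges and deletions, all of them free of cost. A nonempty
  \<open>u\<close> keeps the word from vanishing on the way.\<close>

lemma fills_mult:
  "fills (u @ x @ y) k \<Longrightarrow> u \<noteq> [] \<Longrightarrow> fills (u @ foldr (fp_push A) x y) k"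
proof (induction x arbitrary: u)
  case (Cons l x)
  from Cons.IH[of "u @ [l]"] Cons.prems have "fills (u @ l # foldr (fp_push A) x y) k" by simp
  then show ?case using fills_fp_push[of u "fst l" "snd l"] Cons.prems by simp
qed simp

lemma fills_insert_inverse:
  "fills (u @ v) k \<Longrightarrow> u \<noteq> [] \<Longrightarrow> set w \<subseteq> letters \<Longrightarrow> fills (u @ word_inv w @ w @ v) k"
proof (induction w)
  case (Cons l w)
  obtain j x where l: "l = (j, x)" by (cases l)
  have "fills ((u @ word_inv w) @ w @ v) k" using Cons by simp
  from fills_insert_pair[OF this, of j x] Cons.prems show ?case
    by (simp add: l word_inv_Cons in_letters)
qed (simp add: word_inv_def)

text \<open>Insert \<open>x^-1 x\<close> and then \<open>y^-1 y\<close> between its two halves, both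
  for free; exchange the blocks \<open>y\<close> and \<open>x\<close> at cost 2; multiply out from
  the right.\<close>

lemma fills_commutator:
  assumes "fills (u @ v) k" "u \<noteq> []" "reduced x" "reduced y" "reduced v"
  shows "fills (u @ (commutator (free_product A J) x y \<otimes>\<^bsub>free_product A J\<^esub> v)) (k - 2)"
proof -
  interpret G: group "free_product A J" by (rule free_product_group)
  let ?m = "\<lambda>u v. foldr (fp_push A) u v"
  have "fills (u @ word_inv x @ x @ v) k"
    using fills_insert_inverse assms reduced_letters by blast
  then have "fills ((u @ word_inv x) @ word_inv y @ y @ x @ v) k"
    using fills_insert_inverse[of "u @ word_inv x" "x @ v" k y] assms reduced_letters by simp
  then have "fills ((u @ word_inv x @ word_inv y) @ x @ y @ v) (k - 2)"
    using fills_swap[of "u @ word_inv x @ word_inv y" y x v k] assms(2) by simp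
  then have "fills ((u @ word_inv x @ word_inv y @ x) @ ?m y v) (k - 2)"
    using fills_mult[of "u @ word_inv x @ word_inv y @ x" y v] assms(2) by simp
  then have "fills ((u @ word_inv x @ word_inv y) @ ?m x (?m y v)) (k - 2)"
    using fills_mult[of "u @ word_inv x @ word_inv y" x] assms(2) by simp
  then have "fills ((u @ word_inv x) @ ?m (word_inv y) (?m x (?m y v))) (k - 2)"
    using fills_mult[of "u @ word_inv x" "word_inv y"] assms(2) by simp
  then have "fills (u @ ?m (word_inv x) (?m (word_inv y) (?m x (?m y v)))) (k - 2)"
    using fills_mult[of u "word_inv x"] assms(2) by simp
  moreover have "commutator (free_product A J) x y \<otimes>\<^bsub>free_product A J\<^esub> v
      = ?m (word_inv x) (?m (word_inv y) (?m x (?m y v)))"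
  proof -
    have c: "x \<in> carrier (free_product A J)" "y \<in> carrier (free_product A J)" "v \<in> carrier (free_product A J)"
      using assms by (simp_all add: free_product_simps)
    then show ?thesis unfolding commutator_def free_product_simps(3)[symmetric]
      using assms by (simp add: G.m_assoc flip: free_product_inv)
  qed
  ultimately show ?thesis by simp
qed

text \<open>A trivial letter in front serves as the nonempty prefix of all moves. Deleting it at the
  end requires a nontrivial product.\<close>

lemma fills_comm_product:
  assumes "\<And>i. i < k \<Longrightarrow> f i \<in> carrier (free_product A J) \<and> g i \<in> carrier (free_product A J)"
    "comm_product (free_product A J) f g k \<noteq> []" "j \<in> J"
  shows "fills (comm_product (free_product A J) f g k) (1 - 2 * int k)"
proof -
  interpret G: group "free_product A J" by (rule free_product_group)
  let ?G = "free_product A J"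
  let ?w = "\<lambda>is. foldr (\<lambda>i acc. commutator ?G (f i) (g i) \<otimes>\<^bsub>?G\<^esub> acc) is \<one>\<^bsub>?G\<^esub>"
  have "?w is \<in> carrier ?G \<and> fills ([(j, \<one>\<^bsub>A j\<^esub>)] @ ?w is) (1 - 2 * int (length is))"
    if "set is \<subseteq> {..<k}" for "is"
    using that
  proof (induction "is")
    case Nil
    then show ?case using fills_trivial[OF assms(3)] by (simp add: free_product_simps reduced_Nil)
  next
    case (Cons i "is")
    have fg: "f i \<in> carrier ?G" "g i \<in> carrier ?G" using assms(1)[of i] Cons.prems by auto
    have IH: "?w is \<in> carrier ?G" "fills ([(j, \<one>\<^bsub>A j\<^esub>)] @ ?w is) (1 - 2 * int (length is))"
      using Cons by simp_all
    have "?w (i # is) \<in> carrier ?G" using fg IH(1) by (simp add: commutator_def)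
    moreover have "fills ([(j, \<one>\<^bsub>A j\<^esub>)] @ ?w (i # is)) (1 - 2 * int (length is) - 2)"
      using fills_commutator[OF IH(2), of "f i" "g i"] fg IH(1) by (simp add: free_product_simps(1))
    moreover have "1 - 2 * int (length is) - 2 = 1 - 2 * int (length (i # is))" by simp
    ultimately show ?case by metis
  qed
  from this[of "[0..<k]"] have "fills ([] @ (j, \<one>\<^bsub>A j\<^esub>) # comm_product ?G f g k) (1 - 2 * int k)"
    by (simp add: comm_product_def lessThan_atLeast0)
  from fills_delete[OF this] show ?thesis using assms(2) by simp
qed

end

subsection \<open>Counting the discs of a power of a commutator\<close>

lemma nth_concat_replicate:
  "k < n * length xs \<Longrightarrow> concat (replicate n xs) ! k = xs ! (k mod length xs)"
proof (induction n arbitrary: k)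
  case (Suc n)
  show ?case
  proof (cases "k < length xs")
    case True
    then show ?thesis by (simp add: nth_append)
  next
    case False
    then have "concat (replicate (Suc n) xs) ! k = xs ! ((k - length xs) mod length xs)"
      using Suc.IH[of "k - length xs"] Suc.prems by (simp add: nth_append)
    then show ?thesis using False by (simp add: le_mod_geq)
  qed
qed simp

lemma disjoint_lists_card_le:
  assumes "finite S" "finite M" "disjoint_lists M" "\<And>d. d \<in> M \<Longrightarrow> m \<le> card (set d \<inter> S)"
  shows "m * card M \<le> card S"
proof -
  have "m * card M = (\<Sum>d\<in>M. m)" by simp
  also have "\<dots> \<le> (\<Sum>d\<in>M. card (set d \<inter> S))" by (rule sum_mono) (rule assms(4))
  also have "\<dots> = card (\<Union>d\<in>M. set d \<inter> S)"
    by (rule card_UN_disjoint[symmetric]) (use assms in \<open>auto simp: pairwise_def\<close>)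
  also have "\<dots> \<le> card S" by (rule card_mono) (use assms in auto)
  finally show ?thesis .
qed

lemma cyclic_on_invariant:
  assumes "cyclic_on f d" "x \<in> set d" "P x" "\<And>z. z \<in> set d \<Longrightarrow> P z \<Longrightarrow> P (f z)" "y \<in> set d"
  shows "P y"
proof -
  obtain r u v where r: "d = u @ x # v" "r = v @ u" "cyclic_on f (x # r)"
    using cyclic_on_start[OF assms(1,2)] .
  have inv: "\<forall>z\<in>set (x # r). P z"
    if "successively (\<lambda>x y. f x = y) (x # r)" "P x" "\<forall>z\<in>set (x # r). P z \<longrightarrow> P (f z)" for x r
    using that
  proof (induction r arbitrary: x)
    case (Cons b r)
    then have "f x = b" "P (f x)" by auto
    then show ?case using Cons.IH[of b] Cons.prems by auto
  qed simp
  show ?thesis using inv[of x r] r assms(3,4,5) by (auto simp: cyclic_on_def)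
qed

context group_family
begin

text \<open>Neighbours in the word alternate between two factors and
  \<open>\<phi> \<circ> \<sigma>\<close> preserves factors, so \<phi> switches them and
  \<open>r = \<phi> (\<phi> i)\<close> is in the factor of \<open>i\<close>. If
  \<open>r \<noteq> i\<close>, composing with \<open>transpose i r\<close> splits off the 2-cycle
  \<open>(i j)\<close>; \<phi> gets shorter by one and at most one disc is lost.\<close>

lemma diagram_involution:
  assumes "diagram c lab \<sigma> \<phi> D l" "\<forall>x\<in>set c. fst (lab (\<sigma> x)) \<noteq> fst (lab x)"
    "\<forall>x\<in>set c. fst (lab x) \<in> {j1, j2}"
  shows "\<exists>\<phi>' D' l'. diagram c lab \<sigma> \<phi>' D' l' \<and> (\<forall>x. \<phi>' (\<phi>' x) = x) \<and>
    int (card D) - int l \<le> int (card D') - int l'"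
  using assms(1)
proof (induction l arbitrary: \<phi> D rule: less_induct)
  case (less l)
  show ?case
  proof (cases "\<forall>x. \<phi> (\<phi> x) = x")
    case True
    then show ?thesis using less.prems by blast
  next
    case False
    then obtain i where i: "\<phi> (\<phi> i) \<noteq> i" by blast
    define j where "j = \<phi> i"
    define r where "r = \<phi> j"
    have tp: "transp_prod l \<phi>" and \<sigma>: "cyclic_on \<sigma> c" "bij \<sigma>" "\<And>x. x \<notin> set c \<Longrightarrow> \<sigma> x = x"
      using less.prems by (auto simp: diagram_def)
    have inj: "inj \<phi>" using transp_prod_bij[OF tp] by (rule bij_is_inj)
    have ic: "i \<in> set c"
    proof (rule ccontr)
      assume "i \<notin> set c"
      then have "\<phi> i = i" using less.prems by (auto simp: diagram_def)
      then show False using i by simp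
    qed
    have jc: "j \<in> set c" and rc: "r \<in> set c"
      unfolding j_def r_def using ic diagram_phi_closed[OF less.prems] by auto
    have ji: "j \<noteq> i" using i by (auto simp: j_def)
    have ri: "r \<noteq> i" using i by (auto simp: j_def r_def)
    have rj: "r \<noteq> j" using ji inj by (auto simp: r_def j_def dest: injD)
    have alt: "fst (lab (\<phi> y)) \<noteq> fst (lab y)" if "y \<in> set c" for y
    proof -
      obtain x where x: "y = \<sigma> x" using \<sigma>(2) by (metis bij_pointE)
      have xc: "x \<in> set c" using that x \<sigma>(3) by metis
      then have "fst (lab (\<phi> y)) = fst (lab x)" using less.prems x by (simp add: diagram_def)
      then show ?thesis using assms(2) xc x by metis
    qed
    have "fst (lab r) = fst (lab i)"
      using alt[OF ic] alt[OF jc] assms(3) ic jc rc unfolding j_def[symmetric] r_def[symmetric]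
      by (metis insertE singletonD)
    \<comment> \<open>Taking first \<open>i\<close> and then \<open>j\<close> out of their cycle
      saves two transpositions; putting the pair back as \<open>(i j)\<close> costs one.\<close>
    have "\<phi> i \<noteq> i" using ji by (simp add: j_def)
    from transp_prod_skip[OF tp this] obtain l1 where l1: "l = Suc l1" "transp_prod l1 (transpose i j \<circ> \<phi>)"
      by (auto simp: j_def)
    have qj: "(transpose i j \<circ> \<phi>) j = r" using ri rj by (simp add: r_def[symmetric])
    from transp_prod_skip[OF l1(2), of j] rj obtain l2 where l2: "l1 = Suc l2"
      "transp_prod l2 (transpose j r \<circ> (transpose i j \<circ> \<phi>))" unfolding qj by blast
    have "transpose i j \<circ> (transpose j r \<circ> (transpose i j \<circ> \<phi>)) = transpose i r \<circ> \<phi>"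
      using ji ri rj by (auto simp: fun_eq_iff transpose_def)
    with transp_prod_step[OF l2(2), of i j] have "transp_prod l1 (transpose i r \<circ> \<phi>)"
      unfolding l2(1) by simp
    from diagram_transpose[OF less.prems ic rc _ _ this] ri \<open>fst (lab r) = fst (lab i)\<close>
    obtain D1 where D1: "diagram c lab \<sigma> (transpose i r \<circ> \<phi>) D1 l1" "card D \<le> card D1 + 1"
      by metis
    from less.IH[OF _ D1(1)] l1(1) obtain \<phi>' D' l' where
      "diagram c lab \<sigma> \<phi>' D' l'" "\<forall>x. \<phi>' (\<phi>' x) = x" "int (card D1) - int l1 \<le> int (card D') - int l'"
      by blast
    moreover have "int (card D) - int l \<le> int (card D1) - int l1" using D1(2) l1(1) by simp
    ultimately show ?thesis by (metis order_trans)
  qed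
qed

lemma label_prod_const:
  assumes "j \<in> J" "y \<in> carrier (A j)" "\<And>x. x \<in> set d \<Longrightarrow> snd (lab x) = y"
  shows "label_prod lab j d = y [^]\<^bsub>A j\<^esub> length d"
proof -
  interpret group "A j" by (rule is_group[OF assms(1)])
  have "y \<otimes>\<^bsub>A j\<^esub> y [^]\<^bsub>A j\<^esub> i = y [^]\<^bsub>A j\<^esub> i \<otimes>\<^bsub>A j\<^esub> y" for i :: nat
    using nat_pow_Suc2[OF assms(2), of i] by simp
  then show ?thesis using assms(3) by (induction d) (auto simp: label_prod_Nil label_prod_Cons)
qed

text \<open>The orders enter only as a lower bound \<open>m\<close> for the exponents of trivial
  powers; \<open>m = 0\<close> means that both orders are infinite, and then
  \<open>n div m = 0\<close>. The bound combines \<open>l \<ge> 2 n\<close> with at most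
  \<open>n + 2 (n div m)\<close> discs.\<close>

lemma fills_commutator_power:
  assumes j: "j1 \<in> J" "j2 \<in> J" "j1 \<noteq> j2" and a: "a \<in> carrier (A j1)" and t: "t \<in> carrier (A j2)"
    and n: "n > 0"
    and orda: "\<And>r. r > 0 \<Longrightarrow> a [^]\<^bsub>A j1\<^esub> (r :: nat) = \<one>\<^bsub>A j1\<^esub> \<Longrightarrow> 0 < m \<and> m \<le> r"
    and ordt: "\<And>r. r > 0 \<Longrightarrow> t [^]\<^bsub>A j2\<^esub> (r :: nat) = \<one>\<^bsub>A j2\<^esub> \<Longrightarrow> 0 < m \<and> m \<le> r"
    and fills: "fills (concat (replicate n [(j1, inv\<^bsub>A j1\<^esub> a), (j2, inv\<^bsub>A j2\<^esub> t), (j1, a), (j2, t)])) k"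
  shows "k \<le> 2 * int (n div m) - int n"
proof -
  interpret A1: group "A j1" by (rule is_group[OF j(1)])
  interpret A2: group "A j2" by (rule is_group[OF j(2)])
  define C where "C = [(j1, inv\<^bsub>A j1\<^esub> a), (j2, inv\<^bsub>A j2\<^esub> t), (j1, a), (j2, t)]"
  have lC: "length C = 4" by (simp add: C_def)
  from fills obtain c :: "nat list" and lab \<sigma> \<phi>0 D0 l0 where dg0: "diagram c lab \<sigma> \<phi>0 D0 l0"
    and w: "map lab c = concat (replicate n C)" and k0: "k \<le> int (card D0) - int l0"
    unfolding fills_def C_def by blast
  define X where "X = set c"
  have cyc: "cyclic_on \<sigma> c" and \<sigma>: "bij \<sigma>" "\<And>x. x \<notin> X \<Longrightarrow> \<sigma> x = x"
    using dg0 by (auto simp: diagram_def X_def)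
  have dc: "distinct c" using cyc by (simp add: cyclic_on_def)
  have "length c = length (concat (replicate n C))" using w by (metis length_map)
  then have len: "length c = 4 * n" by (simp add: length_concat sum_list_replicate lC)
  have labc: "lab (c ! i) = C ! (i mod 4)" if "i < 4 * n" for i
    using that nth_concat_replicate[of i n C] w lC len by (metis mult.commute nth_map)
  \<comment> \<open>The classes 0, 1, 2, 3 are the occurrences of \<open>a^-1\<close>, \<open>t^-1\<close>, \<open>a\<close>, \<open>t\<close>; labels cannot separate them if \<open>a^2 = 1\<close>.\<close>
  define cls where "cls = (\<lambda>x. (SOME i. i < 4 * n \<and> c ! i = x) mod 4)"
  have cls: "cls (c ! i) = i mod 4" if "i < 4 * n" for i
  proof -
    have "(SOME k. k < 4 * n \<and> c ! k = c ! i) = i"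
      using that len dc by (intro some_equality) (auto simp: nth_eq_iff_index_eq)
    then show ?thesis by (simp add: cls_def)
  qed
  have Xnth: "\<exists>i<4 * n. x = c ! i" if "x \<in> X" for x
    using that len by (auto simp: X_def in_set_conv_nth)
  have cls4: "cls x < 4" for x by (simp add: cls_def)
  have labx: "lab x = C ! cls x" if "x \<in> X" for x using Xnth[OF that] labc cls by auto
  have cls\<sigma>: "cls (\<sigma> x) = (cls x + 1) mod 4" if xX: "x \<in> X" for x
  proof -
    obtain i where i: "i < 4 * n" "x = c ! i" using Xnth[OF xX] by blast
    show ?thesis
    proof (cases "Suc i < 4 * n")
      case True
      then have "\<sigma> (c ! i) = c ! Suc i" using cyc len by (simp add: cyclic_on_def successively_conv_nth)
      then show ?thesis using cls[OF i(1)] cls[OF True] i(2) by (simp add: mod_Suc_eq)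
    next
      case False
      then have "Suc i = 4 * n" using i(1) by simp
      then have "i = length c - 1" "c \<noteq> []" using len n by auto
      then have "x = last c" using i(2) by (simp add: last_conv_nth)
      then have "\<sigma> x = c ! 0" using cyc by (simp add: cyclic_on_def hd_conv_nth)
      then have "cls (\<sigma> x) = 0" using cls[of 0] n by simp
      moreover have "(cls x + 1) mod 4 = Suc i mod 4" using cls[OF i(1)] i(2) by (simp add: mod_Suc_eq)
      ultimately show ?thesis using \<open>Suc i = 4 * n\<close> by simp
    qed
  qed
  have four: "y = 0 \<or> y = 1 \<or> y = 2 \<or> y = 3" if "y < 4" for y :: nat using that by linarith
  have fac: "fst (lab x) = (if even (cls x) then j1 else j2)" if "x \<in> X" for x
    using four[OF cls4[of x]] labx[OF that] by (auto simp: C_def)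
  have alt: "\<forall>x\<in>set c. fst (lab (\<sigma> x)) \<noteq> fst (lab x)"
  proof
    fix x assume "x \<in> set c"
    then have x: "x \<in> X" "\<sigma> x \<in> X" using diagram_sigma_closed[OF dg0] by (auto simp: X_def)
    have "even (cls (\<sigma> x)) \<longleftrightarrow> odd (cls x)"
      using cls\<sigma>[OF x(1)] four[OF cls4[of x]] by auto
    then show "fst (lab (\<sigma> x)) \<noteq> fst (lab x)" using fac[OF x(1)] fac[OF x(2)] j(3) by auto
  qed
  have two: "\<forall>x\<in>set c. fst (lab x) \<in> {j1, j2}" using fac by (auto simp: X_def)
  obtain \<phi> D l where dg: "diagram c lab \<sigma> \<phi> D l" and invol: "\<And>x. \<phi> (\<phi> x) = x"
    and k: "k \<le> int (card D) - int l"
    using diagram_involution[OF dg0 alt two] k0 by (metis order_trans)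
  define f where "f = \<phi> \<circ> \<sigma>"
  have injf: "inj f" unfolding f_def by (rule diagram_inj[OF dg])
  have fX: "f x \<in> X" if "x \<in> X" for x
    using that diagram_phi_closed[OF dg] diagram_sigma_closed[OF dg] by (simp add: f_def X_def)
  have finX: "finite X" by (simp add: X_def)
  have fin: "finite D" and disj: "disjoint_lists D"
    and discs: "\<And>d. d \<in> D \<Longrightarrow> set d \<subseteq> X \<and> disc lab f d"
    using dg by (auto simp: diagram_def f_def X_def)
  have ff: "fst (lab (f x)) = fst (lab x)" if "x \<in> X" for x
    using dg that by (simp add: diagram_def f_def X_def)
  \<comment> \<open>None of the \<open>4 n\<close> letters is fixed by \<phi>, since \<sigma>
    changes the factor and \<open>\<phi> \<circ> \<sigma>\<close> does not. A transposition moves at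
    most two points.\<close>
  have "2 * n \<le> l"
  proof -
    have "X \<subseteq> {x. \<phi> x \<noteq> x}"
    proof
      fix y assume y: "y \<in> X"
      obtain x where x: "y = \<sigma> x" using \<sigma>(1) by (metis bij_pointE)
      have "x \<in> X" using y x \<sigma>(2) by metis
      then show "y \<in> {x. \<phi> x \<noteq> x}" using ff[of x] alt x by (auto simp: f_def X_def)
    qed
    moreover have "finite {x. \<phi> x \<noteq> x} \<and> card {x. \<phi> x \<noteq> x} \<le> 2 * l"
      using dg by (intro transp_prod_support) (simp add: diagram_def)
    ultimately have "card X \<le> 2 * l" using card_mono[of "{x. \<phi> x \<noteq> x}" X] by linarith
    moreover have "card X = 4 * n" using dc len by (simp add: X_def distinct_card)
    ultimately show ?thesis by simp
  qed
  \<comment> \<open>The cardinalities form a matrix of transition counts along the pieces. Each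
    class has at most \<open>n\<close> letters and \<open>f\<close> is injective, so row and column
    sums are at most \<open>n\<close>.\<close>
  define S where "S = (\<lambda>u v. {x \<in> X. cls x = u \<and> cls (f x) = v})"
  have finS: "finite (S u v)" for u v using finX by (simp add: S_def)
  have cardX: "card {x \<in> X. cls x = u} \<le> n" for u
  proof -
    have "{x \<in> X. cls x = u} \<subseteq> (\<lambda>i. c ! (4 * i + u)) ` {..<n}"
    proof
      fix x assume "x \<in> {x \<in> X. cls x = u}"
      then obtain i where i: "i < 4 * n" "x = c ! i" "i mod 4 = u" using Xnth cls by force
      then have "x = c ! (4 * (i div 4) + u)" "i div 4 \<in> {..<n}" by auto
      then show "x \<in> (\<lambda>i. c ! (4 * i + u)) ` {..<n}" by (rule image_eqI)
    qed
    then show ?thesis using surj_card_le[of "{..<n}"] by simp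
  qed
  have row: "card (S u v) + card (S u v') \<le> n" if "v \<noteq> v'" for u v v'
  proof -
    have "card (S u v) + card (S u v') = card (S u v \<union> S u v')"
      by (rule card_Un_disjoint[symmetric]) (use that finS in \<open>auto simp: S_def\<close>)
    also have "\<dots> \<le> card {x \<in> X. cls x = u}" using finX by (intro card_mono) (auto simp: S_def)
    finally show ?thesis using cardX[of u] by linarith
  qed
  have col: "card (S u v) + card (S u' v) \<le> n" if "u \<noteq> u'" for u u' v
  proof -
    have "card (S u v) + card (S u' v) = card (S u v \<union> S u' v)"
      by (rule card_Un_disjoint[symmetric]) (use that finS in \<open>auto simp: S_def\<close>)
    also have "\<dots> \<le> card {x \<in> X. cls x = v}"
      by (rule card_inj_on_le[of f]) (use injf fX finX in \<open>auto simp: S_def inj_on_def dest: injD\<close>)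
    finally show ?thesis using cardX[of v] by linarith
  qed
  \<comment> \<open>As \<open>\<phi>\<close> is an involution, \<open>f\<close> maps \<open>\<sigma>^-1 (f x)\<close> to \<open>\<sigma> x\<close>.\<close>
  have dual: "card (S u v) \<le> card (S ((v + 3) mod 4) ((u + 1) mod 4))" if "v < 4" for u v
  proof (rule card_inj_on_le[of "\<lambda>x. inv_into UNIV \<sigma> (f x)"])
    have "inj (\<lambda>x. inv_into UNIV \<sigma> (f x))"
      using inj_compose[OF bij_is_inj[OF bij_imp_bij_inv[OF \<sigma>(1)]] injf] by (simp add: comp_def)
    then show "inj_on (\<lambda>x. inv_into UNIV \<sigma> (f x)) (S u v)" by (rule inj_on_subset) simp
    show "finite (S ((v + 3) mod 4) ((u + 1) mod 4))" by (rule finS)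
    show "(\<lambda>x. inv_into UNIV \<sigma> (f x)) ` S u v \<subseteq> S ((v + 3) mod 4) ((u + 1) mod 4)"
    proof clarify
      fix x assume "x \<in> S u v"
      then have x: "x \<in> X" "cls x = u" "cls (f x) = v" by (auto simp: S_def)
      define z where "z = inv_into UNIV \<sigma> (f x)"
      have sz: "\<sigma> z = f x" unfolding z_def using \<sigma>(1) by (simp add: bij_is_surj surj_f_inv_f)
      have zX: "z \<in> X" using \<sigma>(2)[of z] sz fX[OF x(1)] by metis
      have "(cls z + 1) mod 4 = v" using cls\<sigma>[OF zX] sz x(3) by simp
      then have "cls z = (v + 3) mod 4" using four[OF cls4[of z]] by auto
      moreover have "f z = \<sigma> x" using sz invol by (simp add: f_def)
      then have "cls (f z) = (u + 1) mod 4" using cls\<sigma>[OF x(1)] x(2) by simp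
      ultimately show "z \<in> S ((v + 3) mod 4) ((u + 1) mod 4)" using zX by (simp add: S_def)
    qed
  qed
  define M where "M = (\<lambda>u. {d \<in> D. \<forall>x\<in>set d. cls x = u})"
  define T where "T = (\<lambda>u v. {d \<in> D. set d \<inter> S u v \<noteq> {}})"
  have sub: "finite E" "disjoint_lists E" if "E \<subseteq> D" for E
    using that fin finite_subset pairwise_subset[OF disj] by auto
  have T: "card (T u v) \<le> card (S u v)" for u v
  proof -
    have "1 * card (T u v) \<le> card (S u v)"
    proof (rule disjoint_lists_card_le[OF finS])
      show "finite (T u v)" "disjoint_lists (T u v)" using sub[of "T u v"] by (auto simp: T_def)
      show "1 \<le> card (set d \<inter> S u v)" if "d \<in> T u v" for d
        using that finS[of u v] by (simp add: T_def Suc_le_eq card_gt_0_iff)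
    qed
    then show ?thesis by simp
  qed
  \<comment> \<open>The boundary label of such a disc is a power of a single letter, so its
    triviality forces at least \<open>m\<close> letters.\<close>
  have mono_disc: "0 < m \<and> m \<le> card (set d \<inter> S u u)" if "d \<in> M u" for d u
  proof -
    have d: "d \<in> D" "set d \<subseteq> X" "disc lab f d" and cd: "\<forall>x\<in>set d. cls x = u"
      using that discs by (auto simp: M_def)
    have cf: "cyclic_on f d" using d(3) by (simp add: disc_def)
    then have "d \<noteq> []" by (simp add: cyclic_on_def)
    then have u4: "u < 4" using cd cls4 by (metis hd_in_set)
    have "set d \<subseteq> S u u" using cd d(2) cyclic_on_image[OF cf] by (auto simp: S_def)
    then have cds: "card (set d \<inter> S u u) = length d"
      using cf by (simp add: Int_absorb2 cyclic_on_def distinct_card)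
    have labd: "lab x = C ! u" if "x \<in> set d" for x using that cd d(2) labx by auto
    define h where "h = fst (C ! u)"
    define y where "y = snd (C ! u)"
    obtain i where i: "\<forall>x\<in>set d. fst (lab x) = i" "label_prod lab i d = \<one>\<^bsub>A i\<^esub>"
      using d(3) by (auto simp: disc_def)
    have "i = h" using i(1) labd \<open>d \<noteq> []\<close> unfolding h_def by (metis hd_in_set)
    have C4: "h = j1 \<and> (y = a \<or> y = inv\<^bsub>A j1\<^esub> a) \<or> h = j2 \<and> (y = t \<or> y = inv\<^bsub>A j2\<^esub> t)"
      using four[OF u4] by (auto simp: h_def y_def C_def)
    then have hy: "h \<in> J" "y \<in> carrier (A h)" using j a t by auto
    have "label_prod lab h d = y [^]\<^bsub>A h\<^esub> length d"
      by (rule label_prod_const[OF hy]) (simp add: labd y_def)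
    then have p: "y [^]\<^bsub>A h\<^esub> length d = \<one>\<^bsub>A h\<^esub>" using i(2) \<open>i = h\<close> by simp
    have "0 < m \<and> m \<le> length d"
      using C4
    proof
      assume h1: "h = j1 \<and> (y = a \<or> y = inv\<^bsub>A j1\<^esub> a)"
      then have "a [^]\<^bsub>A j1\<^esub> length d = \<one>\<^bsub>A j1\<^esub>"
        using p a by (auto simp: A1.nat_pow_inv A1.inv_eq_1_iff)
      then show ?thesis using orda[of "length d"] \<open>d \<noteq> []\<close> by simp
    next
      assume h1: "h = j2 \<and> (y = t \<or> y = inv\<^bsub>A j2\<^esub> t)"
      then have "t [^]\<^bsub>A j2\<^esub> length d = \<one>\<^bsub>A j2\<^esub>"
        using p t by (auto simp: A2.nat_pow_inv A2.inv_eq_1_iff)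
      then show ?thesis using ordt[of "length d"] \<open>d \<noteq> []\<close> by simp
    qed
    then show ?thesis using cds by simp
  qed
  have M: "m * card (M u) \<le> card (S u u)" for u
  proof (rule disjoint_lists_card_le[OF finS])
    show "finite (M u)" "disjoint_lists (M u)" using sub[of "M u"] by (auto simp: M_def)
    show "m \<le> card (set d \<inter> S u u)" if "d \<in> M u" for d using mono_disc[OF that] by simp
  qed
  \<comment> \<open>Discs of constant class are disjoint and use at least \<open>m\<close>
    transitions each. For \<open>m = 0\<close> there are none, as \<open>mono_disc\<close> gives
    \<open>0 < m\<close>.\<close>
  have MM: "card (M u) + card (M v) \<le> n div m" if "card (S u u) + card (S v v) \<le> n" for u v
  proof (cases "m = 0")
    case True
    then have "M u = {}" "M v = {}" using mono_disc by blast+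
    then show ?thesis by simp
  next
    case False
    have "(card (M u) + card (M v)) * m \<le> n" using M[of u] M[of v] that by (simp add: algebra_simps)
    then show ?thesis using False by (simp add: less_eq_div_iff_mult_less_eq)
  qed
  \<comment> \<open>A transition from \<open>t^-1\<close> to \<open>t^-1\<close> is dual to one from
    \<open>a^-1\<close> to \<open>a\<close>, so both counts fit into the row of
    \<open>a^-1\<close>.\<close>
  have "card (S 0 0) + card (S 1 1) \<le> n" using dual[of 1 1] row[of 2 0 0] by (simp add: numeral_2_eq_2)
  then have M01: "card (M 0) + card (M 1) \<le> n div m" by (rule MM)
  \<comment> \<open>Similarly, \<open>t\<close> to \<open>t\<close> is dual to \<open>a\<close> to
    \<open>a^-1\<close>, and the row of \<open>a\<close> applies.\<close>
  have "card (S 2 2) + card (S 3 3) \<le> n" using dual[of 3 3] row[of 2 0 2] by simp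
  then have M23: "card (M 2) + card (M 3) \<le> n div m" by (rule MM)
  \<comment> \<open>Here \<open>t^-1\<close> to \<open>t\<close> is dual to \<open>a\<close> to
    \<open>a\<close>, and the column of \<open>a\<close> applies.\<close>
  have TT: "card (T 0 2) + card (T 1 3) \<le> n"
    using T[of 0 2] T[of 1 3] dual[of 3 1] col[of 0 2 2] by (simp add: numeral_2_eq_2)
  have "D \<subseteq> (M 0 \<union> M 1) \<union> (M 2 \<union> M 3) \<union> (T 0 2 \<union> T 1 3)"
  proof
    fix d assume dD: "d \<in> D"
    then have d: "set d \<subseteq> X" "disc lab f d" using discs by auto
    have cf: "cyclic_on f d" using d(2) by (simp add: disc_def)
    obtain i where i: "\<forall>x\<in>set d. fst (lab x) = i" using d(2) by (auto simp: disc_def)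
    \<comment> \<open>A cycle that visits class \<open>u\<close> but never steps from
      \<open>u\<close> to \<open>u + 2\<close> stays in \<open>u\<close> for ever.\<close>
    have key: "d \<in> M u \<union> M (u + 2) \<union> T u (u + 2)" if u: "\<forall>x\<in>set d. cls x = u \<or> cls x = u + 2" for u
    proof (cases "\<exists>x\<in>set d. cls x = u")
      case False
      then show ?thesis using u dD by (auto simp: M_def)
    next
      case True
      then obtain x where x: "x \<in> set d" "cls x = u" by blast
      show ?thesis
      proof (cases "d \<in> T u (u + 2)")
        case False
        have "cls (f z) = u" if "z \<in> set d" "cls z = u" for z
        proof -
          have "f z \<in> set d" by (rule cyclic_on_image[OF cf that(1)])
          moreover have "z \<notin> S u (u + 2)" using False dD that(1) by (auto simp: T_def)
          ultimately show ?thesis using u that d(1) by (auto simp: S_def)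
        qed
        then have "\<forall>y\<in>set d. cls y = u"
          using cyclic_on_invariant[OF cf x(1), of "\<lambda>z. cls z = u"] x(2) by blast
        then show ?thesis using dD by (simp add: M_def)
      qed simp
    qed
    show "d \<in> (M 0 \<union> M 1) \<union> (M 2 \<union> M 3) \<union> (T 0 2 \<union> T 1 3)"
    proof (cases "i = j1")
      case True
      have "cls x = 0 \<or> cls x = 0 + 2" if "x \<in> set d" for x
        using fac[of x] i that True d(1) j(3) four[OF cls4[of x]] by (auto split: if_splits)
      then show ?thesis using key[of 0] by (auto simp: numeral_2_eq_2)
    next
      case False
      have "cls x = 1 \<or> cls x = 1 + 2" if "x \<in> set d" for x
        using fac[of x] i that False d(1) four[OF cls4[of x]] by (auto split: if_splits)
      then show ?thesis using key[of 1] by (auto simp: numeral_3_eq_3 numeral_2_eq_2)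
    qed
  qed
  then have "card D \<le> card ((M 0 \<union> M 1) \<union> (M 2 \<union> M 3) \<union> (T 0 2 \<union> T 1 3))"
    using fin by (intro card_mono) (auto simp: M_def T_def)
  also have "\<dots> \<le> card ((M 0 \<union> M 1) \<union> (M 2 \<union> M 3)) + card (T 0 2 \<union> T 1 3)" by (rule card_Un_le)
  also have "\<dots> \<le> card (M 0 \<union> M 1) + card (M 2 \<union> M 3) + (card (T 0 2) + card (T 1 3))"
    using card_Un_le[of "M 0 \<union> M 1" "M 2 \<union> M 3"] card_Un_le[of "T 0 2" "T 1 3"] by linarith
  also have "\<dots> \<le> n div m + n div m + n"
    using card_Un_le[of "M 0" "M 1"] card_Un_le[of "M 2" "M 3"] M01 M23 TT by linarith
  finally show ?thesis using k \<open>2 * n \<le> l\<close> by linarith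
qed

end

subsection \<open>Products of commutators in an arbitrary group\<close>

context group
begin

text \<open>A recursive counterpart of \<open>comm_product\<close> without sequences of factors;
  \<open>comm_prod_imp_comm_product\<close> leads back to it.\<close>

primrec comm_prod :: "nat \<Rightarrow> 'a \<Rightarrow> bool" where
  "comm_prod 0 h \<longleftrightarrow> h = \<one>"
| "comm_prod (Suc k) h \<longleftrightarrow> (\<exists>x\<in>carrier G. \<exists>y\<in>carrier G. \<exists>h'. comm_prod k h' \<and> h = commutator G x y \<otimes> h')"

lemma commutator_closed: "x \<in> carrier G \<Longrightarrow> y \<in> carrier G \<Longrightarrow> commutator G x y \<in> carrier G"
  by (simp add: commutator_def)

lemma comm_prod_closed: "comm_prod k h \<Longrightarrow> h \<in> carrier G"
  by (induction k arbitrary: h) (auto simp: commutator_closed)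

lemma inv_cancel:
  "x \<in> carrier G \<Longrightarrow> y \<in> carrier G \<Longrightarrow> inv x \<otimes> (x \<otimes> y) = y"
  "x \<in> carrier G \<Longrightarrow> y \<in> carrier G \<Longrightarrow> x \<otimes> (inv x \<otimes> y) = y"
  by (simp_all add: m_assoc[symmetric])

lemma comm_product_Suc:
  "comm_product G (case_nat x f) (case_nat y g) (Suc k) = commutator G x y \<otimes> comm_product G f g k"
proof -
  have "[0..<Suc k] = 0 # map Suc [0..<k]" by (simp add: upt_conv_Cons map_Suc_upt del: upt_Suc)
  then show ?thesis by (simp add: comm_product_def foldr_map comp_def del: upt_Suc)
qed

lemma comm_prod_imp_comm_product:
  "comm_prod k h \<Longrightarrow> \<exists>f g. (\<forall>i<k. f i \<in> carrier G \<and> g i \<in> carrier G) \<and> h = comm_product G f g k"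
proof (induction k arbitrary: h)
  case 0
  then show ?case by (simp add: comm_product_def)
next
  case (Suc k)
  then obtain x y h' where xy: "x \<in> carrier G" "y \<in> carrier G" "comm_prod k h'" "h = commutator G x y \<otimes> h'"
    by auto
  from Suc.IH[OF xy(3)] obtain f g where fg: "\<forall>i<k. f i \<in> carrier G \<and> g i \<in> carrier G" "h' = comm_product G f g k"
    by blast
  have "h = comm_product G (case_nat x f) (case_nat y g) (Suc k)" using xy(4) fg(2) comm_product_Suc by simp
  moreover have "\<forall>i<Suc k. case_nat x f i \<in> carrier G \<and> case_nat y g i \<in> carrier G"
    using fg(1) xy(1,2) by (auto split: nat.split)
  ultimately show ?case by blast
qed

lemma comm_prod_Suc: "comm_prod k h \<Longrightarrow> comm_prod (Suc k) h"
proof -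
  assume h: "comm_prod k h"
  have "h = commutator G \<one> \<one> \<otimes> h" using comm_prod_closed[OF h] by (simp add: commutator_def)
  then show ?thesis using h by auto
qed

lemma comm_prod_mono: "comm_prod k h \<Longrightarrow> k \<le> k' \<Longrightarrow> comm_prod k' h"
  by (rule dec_induct[of k k' "\<lambda>k. comm_prod k h"]) (auto intro: comm_prod_Suc simp del: comm_prod.simps)

lemma comm_prod_mult: "comm_prod k g \<Longrightarrow> comm_prod l h \<Longrightarrow> comm_prod (k + l) (g \<otimes> h)"
proof (induction k arbitrary: g)
  case 0
  then show ?case using comm_prod_closed[of l h] by simp
next
  case (Suc k)
  then obtain x y g' where g: "x \<in> carrier G" "y \<in> carrier G" "comm_prod k g'" "g = commutator G x y \<otimes> g'"
    by auto
  have "g \<otimes> h = commutator G x y \<otimes> (g' \<otimes> h)"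
    using g comm_prod_closed[OF g(3)] comm_prod_closed[OF Suc.prems(2)] by (simp add: m_assoc commutator_closed)
  then show ?case using Suc.IH[OF g(3) Suc.prems(2)] g(1,2) by auto
qed

section \<open>Conjugation, rotation and reversal of blocks\<close>

lemma comm_prod_conj:
  "comm_prod k h \<Longrightarrow> g \<in> carrier G \<Longrightarrow> comm_prod k (inv g \<otimes> h \<otimes> g)"
proof (induction k arbitrary: h)
  case (Suc k)
  then obtain x y h' where h: "x \<in> carrier G" "y \<in> carrier G" "comm_prod k h'" "h = commutator G x y \<otimes> h'"
    by auto
  have "inv g \<otimes> h \<otimes> g = commutator G (inv g \<otimes> x \<otimes> g) (inv g \<otimes> y \<otimes> g) \<otimes> (inv g \<otimes> h' \<otimes> g)"
    using h comm_prod_closed[OF h(3)] Suc.prems(2)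
    by (simp add: commutator_def m_assoc inv_mult_group inv_cancel)
  then show ?case using Suc.IH[OF h(3) Suc.prems(2)] h(1,2) Suc.prems(2)
    by (metis comm_prod.simps(2) inv_closed m_closed)
qed simp

text \<open>Conjugating \<open>v u\<close> by \<open>v\<close> gives \<open>u v\<close>, so words
  may be treated as cyclic.\<close>

lemma comm_prod_rotate:
  assumes "comm_prod k (v \<otimes> u)" "u \<in> carrier G" "v \<in> carrier G"
  shows "comm_prod k (u \<otimes> v)"
  using comm_prod_conj[OF assms(1,3)] assms(2,3) by (simp add: m_assoc inv_cancel)

text \<open>The identity \<open>a b c = [(a b)^-1, (c a^-1)^-1] c b a\<close>, with the commutator
  conjugated past the prefix \<open>p\<close>.\<close>

lemma comm_prod_reverse:
  assumes "comm_prod k (p \<otimes> (c \<otimes> (b \<otimes> (a \<otimes> s))))"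
    "p \<in> carrier G" "a \<in> carrier G" "b \<in> carrier G" "c \<in> carrier G" "s \<in> carrier G"
  shows "comm_prod (Suc k) (p \<otimes> (a \<otimes> (b \<otimes> (c \<otimes> s))))"
proof -
  let ?x = "p \<otimes> inv (a \<otimes> b) \<otimes> inv p" and ?y = "p \<otimes> inv (c \<otimes> inv a) \<otimes> inv p"
  have "p \<otimes> (a \<otimes> (b \<otimes> (c \<otimes> s))) = commutator G ?x ?y \<otimes> (p \<otimes> (c \<otimes> (b \<otimes> (a \<otimes> s))))"
    using assms by (simp add: commutator_def m_assoc inv_mult_group inv_cancel)
  then show ?thesis using assms by (metis comm_prod.simps(2) inv_closed m_closed)
qed

text \<open>Abstracts the relation between \<open>x = a^-1\<close> and \<open>y = t^-1 a t\<close>.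
  It is symmetric and passes to equal powers, and it makes \<open>x y\<close> a commutator.\<close>

definition conj_inv :: "'a \<Rightarrow> 'a \<Rightarrow> bool" where
  "conj_inv x y \<longleftrightarrow> (\<exists>g\<in>carrier G. y = inv g \<otimes> inv x \<otimes> g)"

lemma conj_invI: "g \<in> carrier G \<Longrightarrow> y = inv g \<otimes> inv x \<otimes> g \<Longrightarrow> conj_inv x y"
  by (auto simp: conj_inv_def)

lemma conj_inv_sym:
  assumes "conj_inv x y" "x \<in> carrier G"
  shows "conj_inv y x"
proof -
  from assms(1) obtain g where g: "g \<in> carrier G" "y = inv g \<otimes> inv x \<otimes> g" by (auto simp: conj_inv_def)
  then have "x = inv (inv g) \<otimes> inv y \<otimes> inv g" using assms(2) by (simp add: m_assoc inv_mult_group inv_cancel)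
  then show ?thesis by (rule conj_invI[rotated]) (use g in simp)
qed

lemma conj_inv_conj:
  assumes "conj_inv x y" "x \<in> carrier G" "h \<in> carrier G"
  shows "conj_inv x (inv h \<otimes> y \<otimes> h)"
proof -
  from assms(1) obtain g where g: "g \<in> carrier G" "y = inv g \<otimes> inv x \<otimes> g" by (auto simp: conj_inv_def)
  then have "inv h \<otimes> y \<otimes> h = inv (g \<otimes> h) \<otimes> inv x \<otimes> (g \<otimes> h)"
    using assms(2,3) by (simp add: m_assoc inv_mult_group)
  then show ?thesis by (rule conj_invI[rotated]) (use g assms in simp)
qed

lemma nat_pow_conj:
  assumes "g \<in> carrier G" "z \<in> carrier G"
  shows "(inv g \<otimes> z \<otimes> g) [^] (i :: nat) = inv g \<otimes> z [^] i \<otimes> g"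
  by (induction i) (use assms in \<open>simp_all add: m_assoc inv_cancel\<close>)

lemma conj_inv_pow:
  assumes "conj_inv x y" "x \<in> carrier G"
  shows "conj_inv (x [^] (i :: nat)) (y [^] i)"
proof -
  from assms(1) obtain g where g: "g \<in> carrier G" "y = inv g \<otimes> inv x \<otimes> g" by (auto simp: conj_inv_def)
  then have "y [^] i = inv g \<otimes> inv (x [^] i) \<otimes> g" using assms(2) by (simp add: nat_pow_conj nat_pow_inv)
  then show ?thesis by (rule conj_invI[rotated]) (use g in simp)
qed

lemma comm_prod_conj_inv:
  assumes "conj_inv x y" "x \<in> carrier G"
  shows "comm_prod 1 (x \<otimes> y)"
proof -
  from assms(1) obtain g where g: "g \<in> carrier G" "y = inv g \<otimes> inv x \<otimes> g" by (auto simp: conj_inv_def)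
  then have "x \<otimes> y = commutator G (inv x) g \<otimes> \<one>" using assms(2) by (simp add: commutator_def m_assoc)
  then show ?thesis using g assms(2) by (auto simp del: r_one)
qed

section \<open>Reversals on the words \<open>x^i y^i (xy)^v\<close>\<close>

lemma pow_commute:
  assumes "x \<in> carrier G"
  shows "x \<otimes> x [^] (i :: nat) = x [^] i \<otimes> x"
    "z \<in> carrier G \<Longrightarrow> x \<otimes> (x [^] i \<otimes> z) = x [^] i \<otimes> (x \<otimes> z)"
proof -
  show *: "x \<otimes> x [^] i = x [^] i \<otimes> x" using nat_pow_Suc2[OF assms, of i] by simp
  show "x \<otimes> (x [^] i \<otimes> z) = x [^] i \<otimes> (x \<otimes> z)" if "z \<in> carrier G"
    using that assms * by (simp add: m_assoc[symmetric])
qed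

lemma pow_mult_shift:
  assumes "x \<in> carrier G" "y \<in> carrier G"
  shows "(y \<otimes> x) [^] (i :: nat) \<otimes> y = y \<otimes> (x \<otimes> y) [^] i"
proof (induction i)
  case (Suc i)
  have "(y \<otimes> x) [^] Suc i \<otimes> y = (y \<otimes> x) [^] i \<otimes> y \<otimes> (x \<otimes> y)" using assms by (simp add: m_assoc)
  then show ?case using Suc assms by (simp add: m_assoc)
qed (use assms in simp)

text \<open>The reversed blocks are \<open>y^i\<close>, \<open>xy\<close> and \<open>x\<close>:
  afterwards the letters \<open>x\<close> and \<open>y\<close> stand next to the powers of the same
  element.\<close>

lemma comm_prod_step:
  assumes "x \<in> carrier G" "y \<in> carrier G"
    "comm_prod k (x [^] (i + 2) \<otimes> y [^] (i + 2) \<otimes> (x \<otimes> y) [^] (v :: nat))"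
  shows "comm_prod (Suc k) (x [^] i \<otimes> y [^] (i :: nat) \<otimes> (x \<otimes> y) [^] (v + 2))"
proof -
  define X Y W where "X = x [^] i" and "Y = y [^] i" and "W = (x \<otimes> y) [^] v"
  have c: "X \<in> carrier G" "Y \<in> carrier G" "W \<in> carrier G" using assms by (simp_all add: X_def Y_def W_def)
  have yY: "y \<otimes> (Y \<otimes> z) = Y \<otimes> (y \<otimes> z)" if "z \<in> carrier G" for z
    using pow_commute(2)[OF assms(2) that] by (simp add: Y_def)
  have w: "(x \<otimes> y) [^] (v + 2) = x \<otimes> y \<otimes> (x \<otimes> y \<otimes> W)"
    using assms(1,2) nat_pow_Suc2[of "x \<otimes> y"] by (simp add: W_def m_assoc del: nat_pow_Suc)
  have "x [^] (i + 2) \<otimes> y [^] (i + 2) \<otimes> (x \<otimes> y) [^] v = X \<otimes> (x \<otimes> ((x \<otimes> y) \<otimes> (Y \<otimes> (y \<otimes> W))))"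
    using assms(1,2) c yY by (simp add: X_def[symmetric] Y_def[symmetric] W_def[symmetric] m_assoc)
  with assms(3) have "comm_prod k (X \<otimes> (x \<otimes> ((x \<otimes> y) \<otimes> (Y \<otimes> (y \<otimes> W)))))" by simp
  from comm_prod_reverse[OF this] have "comm_prod (Suc k) (X \<otimes> (Y \<otimes> ((x \<otimes> y) \<otimes> (x \<otimes> (y \<otimes> W)))))"
    using assms(1,2) c by (simp del: comm_prod.simps)
  moreover have "x [^] i \<otimes> y [^] i \<otimes> (x \<otimes> y) [^] (v + 2) = X \<otimes> (Y \<otimes> ((x \<otimes> y) \<otimes> (x \<otimes> (y \<otimes> W))))"
    unfolding w using assms(1,2) c by (simp add: X_def[symmetric] Y_def[symmetric] m_assoc)
  ultimately show ?thesis by (simp del: comm_prod.simps)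
qed

text \<open>The reversed blocks are \<open>Y\<close>, \<open>(xy)^(v+2)\<close> and \<open>x\<close>; here \<open>X = x^(m-2)\<close> and \<open>Y = y^(m-2)\<close>.\<close>

lemma comm_prod_wrap2:
  assumes xy: "x \<in> carrier G" "y \<in> carrier G" and X: "X \<in> carrier G" "Y \<in> carrier G"
    and one: "X \<otimes> (x \<otimes> x) = \<one>" "y \<otimes> (Y \<otimes> y) = \<one>"
    and k: "comm_prod k (x [^] (2 :: nat) \<otimes> y [^] (2 :: nat) \<otimes> (x \<otimes> y) [^] (v :: nat))"
  shows "comm_prod (Suc k) (X \<otimes> Y \<otimes> (x \<otimes> y) [^] (v + 4))"
proof -
  define W U where "W = (x \<otimes> y) [^] v" and "U = (y \<otimes> x) [^] v"
  have c: "W \<in> carrier G" "U \<in> carrier G" using xy by (simp_all add: W_def U_def)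
  have Uy: "U \<otimes> y = y \<otimes> W" unfolding U_def W_def by (rule pow_mult_shift[OF xy])
  have "x [^] (2 :: nat) \<otimes> y [^] (2 :: nat) \<otimes> (x \<otimes> y) [^] v = (x \<otimes> (x \<otimes> y)) \<otimes> (U \<otimes> y)"
    using xy c by (simp add: Uy W_def[symmetric] numeral_2_eq_2 m_assoc)
  with k have "comm_prod k ((x \<otimes> (x \<otimes> y)) \<otimes> (U \<otimes> y))" by simp
  from comm_prod_rotate[OF this] have 1: "comm_prod k ((U \<otimes> y) \<otimes> (x \<otimes> (x \<otimes> y)))" using xy c by simp
  define V where "V = (x \<otimes> y) [^] Suc v"
  have V: "V \<in> carrier G" "(x \<otimes> y) [^] (v + 2) = x \<otimes> y \<otimes> V"
    "y \<otimes> V = U \<otimes> (y \<otimes> (x \<otimes> y))"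
  proof -
    show "V \<in> carrier G" using xy by (simp add: V_def)
    show "(x \<otimes> y) [^] (v + 2) = x \<otimes> y \<otimes> V"
      unfolding V_def using nat_pow_Suc2[of "x \<otimes> y" "Suc v"] xy by simp
    have "y \<otimes> V = y \<otimes> W \<otimes> (x \<otimes> y)" unfolding V_def W_def using xy by (simp add: m_assoc)
    then show "y \<otimes> V = U \<otimes> (y \<otimes> (x \<otimes> y))" using xy c by (simp add: Uy[symmetric] m_assoc)
  qed
  let ?s = "y \<otimes> (x \<otimes> y)"
  \<comment> \<open>In the reversed word \<open>X x x\<close> and then \<open>y Y y\<close> become
    adjacent and vanish. What is left is a rotation of \<open>x^2 y^2 (xy)^v\<close>.\<close>
  have "X \<otimes> (x \<otimes> ((x \<otimes> y) [^] (v + 2) \<otimes> (Y \<otimes> ?s))) = (X \<otimes> (x \<otimes> x)) \<otimes> ((y \<otimes> V) \<otimes> (Y \<otimes> ?s))"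
    unfolding V(2) using xy X V(1) by (simp add: m_assoc)
  also have "\<dots> = U \<otimes> (y \<otimes> (x \<otimes> ((y \<otimes> (Y \<otimes> y)) \<otimes> (x \<otimes> y))))"
    unfolding one(1) V(3) using xy X c by (simp add: m_assoc)
  also have "\<dots> = (U \<otimes> y) \<otimes> (x \<otimes> (x \<otimes> y))" unfolding one(2) using xy c by (simp add: m_assoc)
  finally have "comm_prod k (X \<otimes> (x \<otimes> ((x \<otimes> y) [^] (v + 2) \<otimes> (Y \<otimes> ?s))))" using 1 by simp
  from comm_prod_reverse[OF this] have 2: "comm_prod (Suc k) (X \<otimes> (Y \<otimes> ((x \<otimes> y) [^] (v + 2) \<otimes> (x \<otimes> ?s))))"
    using xy X by (simp del: comm_prod.simps)
  have "(x \<otimes> y) [^] (v + 4) = (x \<otimes> y) [^] (v + 2) \<otimes> (x \<otimes> y) [^] (2 :: nat)"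
    using nat_pow_mult[OF m_closed[OF xy], of "v + 2" 2] by (simp only: add.assoc numeral_plus_numeral add_num_simps)
  then have "(x \<otimes> y) [^] (v + 4) = (x \<otimes> y) [^] (v + 2) \<otimes> (x \<otimes> ?s)"
    using xy by (simp add: numeral_2_eq_2 m_assoc)
  then show ?thesis using 2 X xy by (simp add: m_assoc del: comm_prod.simps)
qed

text \<open>The reversed blocks are \<open>x(yx)^s\<close>, \<open>yx\<close> and \<open>yxy\<close>; here \<open>x^(m-1) = x^-1\<close>.\<close>

lemma comm_prod_wrap1:
  assumes xy: "x \<in> carrier G" "y \<in> carrier G"
    and k: "comm_prod k (y \<otimes> (y \<otimes> (x \<otimes> (x \<otimes> ((y \<otimes> x) [^] (s :: nat) \<otimes> (x \<otimes> y) [^] (e :: nat))))))"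
  shows "comm_prod (Suc k) (inv x \<otimes> inv y \<otimes> (x \<otimes> y) [^] (s + 3 + e))"
proof -
  define U W where "U = (y \<otimes> x) [^] s" and "W = (x \<otimes> y) [^] e"
  have c: "W \<in> carrier G" "U \<in> carrier G" using xy by (simp_all add: W_def U_def)
  \<comment> \<open>In the reversed word both inverses cancel against the block \<open>yxy\<close>,
    which leaves its last \<open>y\<close>.\<close>
  have "y \<otimes> (y \<otimes> (x \<otimes> (x \<otimes> (U \<otimes> W))))
      = (inv x \<otimes> inv y) \<otimes> ((y \<otimes> (x \<otimes> y)) \<otimes> ((y \<otimes> x) \<otimes> ((x \<otimes> U) \<otimes> W)))"
    using xy c by (simp add: m_assoc inv_cancel)
  with k have "comm_prod k ((inv x \<otimes> inv y) \<otimes> ((y \<otimes> (x \<otimes> y)) \<otimes> ((y \<otimes> x) \<otimes> ((x \<otimes> U) \<otimes> W))))"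
    by (simp add: U_def W_def)
  from comm_prod_reverse[OF this]
  have 1: "comm_prod (Suc k) ((inv x \<otimes> inv y) \<otimes> ((x \<otimes> U) \<otimes> ((y \<otimes> x) \<otimes> ((y \<otimes> (x \<otimes> y)) \<otimes> W))))"
    using xy c by (simp del: comm_prod.simps)
  have "x \<otimes> U = (x \<otimes> y) [^] s \<otimes> x" unfolding U_def using pow_mult_shift[of y x s] xy by simp
  then have "(x \<otimes> U) \<otimes> ((y \<otimes> x) \<otimes> ((y \<otimes> (x \<otimes> y)) \<otimes> W)) = (x \<otimes> y) [^] s \<otimes> (x \<otimes> y) [^] (3 :: nat) \<otimes> W"
    using xy c by (simp add: m_assoc numeral_3_eq_3)
  also have "\<dots> = (x \<otimes> y) [^] (s + 3 + e)" unfolding W_def using xy by (simp only: nat_pow_mult m_closed)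
  finally show ?thesis using 1 by simp
qed

text \<open>The case \<open>s = 0\<close> of \<open>comm_prod_wrap1\<close>. The remaining word is a
  rotation of \<open>y^3 x^3 (yx)^e\<close>, so \<open>x\<close> and \<open>y\<close> have exchanged
  roles.\<close>

lemma comm_prod_wrap1_cubes:
  assumes xy: "x \<in> carrier G" "y \<in> carrier G"
    and k: "comm_prod k (y [^] (3 :: nat) \<otimes> x [^] (3 :: nat) \<otimes> (y \<otimes> x) [^] (e :: nat))"
  shows "comm_prod (Suc k) (inv x \<otimes> inv y \<otimes> (x \<otimes> y) [^] (e + 4))"
proof -
  define U where "U = (y \<otimes> x) [^] e"
  have c: "U \<in> carrier G" using xy by (simp add: U_def)
  have W: "y \<otimes> (x \<otimes> y) [^] e = U \<otimes> y" unfolding U_def by (rule pow_mult_shift[OF xy, symmetric])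
  have "y [^] (3 :: nat) \<otimes> x [^] (3 :: nat) \<otimes> (y \<otimes> x) [^] e = y \<otimes> (y \<otimes> (y \<otimes> (x \<otimes> (x \<otimes> (x \<otimes> U)))))"
    using xy c by (simp add: U_def[symmetric] m_assoc numeral_3_eq_3)
  with k have "comm_prod k (y \<otimes> (y \<otimes> (y \<otimes> (x \<otimes> (x \<otimes> (x \<otimes> U))))))" by simp
  from comm_prod_rotate[OF this] have 1: "comm_prod k ((y \<otimes> (y \<otimes> (x \<otimes> (x \<otimes> (x \<otimes> U))))) \<otimes> y)"
    using xy c by simp
  have "(x \<otimes> y) [^] (e + 1) = x \<otimes> (U \<otimes> y)"
    unfolding W[symmetric] using nat_pow_Suc2[of "x \<otimes> y" e] xy by (simp add: m_assoc)
  then have "(y \<otimes> (y \<otimes> (x \<otimes> (x \<otimes> (x \<otimes> U))))) \<otimes> y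
      = y \<otimes> (y \<otimes> (x \<otimes> (x \<otimes> ((y \<otimes> x) [^] (0 :: nat) \<otimes> (x \<otimes> y) [^] (e + 1)))))"
    using xy c by (simp add: m_assoc)
  then have "comm_prod (Suc k) (inv x \<otimes> inv y \<otimes> (x \<otimes> y) [^] (0 + 3 + (e + 1)))"
    using 1 by (intro comm_prod_wrap1[OF xy]) simp
  then show ?thesis by (simp add: add.commute del: comm_prod.simps)
qed

text \<open>For order 3 the choice \<open>s = 1\<close> makes further cubes of \<open>x\<close> and
  \<open>y\<close> appear under rotation. One reversal absorbs six factors \<open>xy\<close>,
  corresponding to two passed multiples of 3.\<close>

lemma comm_prod_wrap1_order3:
  assumes xy: "x \<in> carrier G" "y \<in> carrier G" "x \<otimes> (x \<otimes> x) = \<one>" "y \<otimes> (y \<otimes> y) = \<one>"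
    and k: "comm_prod k (y [^] (2 :: nat) \<otimes> x [^] (2 :: nat) \<otimes> (y \<otimes> x) [^] (e :: nat))"
  shows "comm_prod (Suc k) (inv x \<otimes> inv y \<otimes> (x \<otimes> y) [^] (e + 6))"
proof -
  have x3: "x \<otimes> (x \<otimes> (x \<otimes> z)) = z" "y \<otimes> (y \<otimes> (y \<otimes> z)) = z" if "z \<in> carrier G" for z
    using xy that by (metis l_one m_assoc m_closed)+
  define U W where "U = (y \<otimes> x) [^] e" and "W = (x \<otimes> y) [^] e"
  have c: "U \<in> carrier G" "W \<in> carrier G" using xy by (simp_all add: U_def W_def)
  have W: "y \<otimes> W = U \<otimes> y" unfolding U_def W_def by (rule pow_mult_shift[OF xy(1,2), symmetric])
  have "y [^] (2 :: nat) \<otimes> x [^] (2 :: nat) \<otimes> (y \<otimes> x) [^] e = y \<otimes> (y \<otimes> (x \<otimes> (x \<otimes> U)))"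
    using xy c by (simp add: U_def[symmetric] m_assoc numeral_2_eq_2)
  with k have "comm_prod k (y \<otimes> (y \<otimes> (x \<otimes> (x \<otimes> U))))" by simp
  from comm_prod_rotate[OF this] have "comm_prod k ((y \<otimes> (x \<otimes> (x \<otimes> U))) \<otimes> y)" using xy c by simp
  moreover have "(y \<otimes> (x \<otimes> (x \<otimes> U))) \<otimes> y = y \<otimes> (x \<otimes> (x \<otimes> (y \<otimes> W)))" unfolding W using xy c by (simp add: m_assoc)
  also have "\<dots> = x \<otimes> (x \<otimes> (x \<otimes> (y \<otimes> (x \<otimes> (x \<otimes> (y \<otimes> W))))))" using xy c x3 by simp
  ultimately have "comm_prod k (x \<otimes> (x \<otimes> (x \<otimes> (y \<otimes> (x \<otimes> (x \<otimes> (y \<otimes> W)))))))" by simp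
  from comm_prod_rotate[OF this] have "comm_prod k ((x \<otimes> (x \<otimes> (y \<otimes> (x \<otimes> (x \<otimes> (y \<otimes> W)))))) \<otimes> x)"
    using xy c by simp
  moreover have "(x \<otimes> (x \<otimes> (y \<otimes> (x \<otimes> (x \<otimes> (y \<otimes> W)))))) \<otimes> x
      = y \<otimes> (y \<otimes> (y \<otimes> (x \<otimes> (x \<otimes> (y \<otimes> (x \<otimes> (x \<otimes> (y \<otimes> (W \<otimes> x)))))))))"
    using xy c x3 by (simp add: m_assoc)
  ultimately have "comm_prod k (y \<otimes> (y \<otimes> (y \<otimes> (x \<otimes> (x \<otimes> (y \<otimes> (x \<otimes> (x \<otimes> (y \<otimes> (W \<otimes> x))))))))))" by simp
  from comm_prod_rotate[OF this]
  have 1: "comm_prod k ((y \<otimes> (y \<otimes> (x \<otimes> (x \<otimes> (y \<otimes> (x \<otimes> (x \<otimes> (y \<otimes> (W \<otimes> x))))))))) \<otimes> y)"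
    using xy c by simp
  have "(x \<otimes> y) [^] (e + 2) = (x \<otimes> y) \<otimes> W \<otimes> (x \<otimes> y)"
    unfolding W_def using nat_pow_Suc2[of "x \<otimes> y" e] xy by simp
  then have "y \<otimes> (y \<otimes> (x \<otimes> (x \<otimes> ((y \<otimes> x) [^] (1 :: nat) \<otimes> (x \<otimes> y) [^] (e + 2)))))
      = (y \<otimes> (y \<otimes> (x \<otimes> (x \<otimes> (y \<otimes> (x \<otimes> (x \<otimes> (y \<otimes> (W \<otimes> x))))))))) \<otimes> y"
    using xy c by (simp add: m_assoc)
  then have "comm_prod (Suc k) (inv x \<otimes> inv y \<otimes> (x \<otimes> y) [^] (1 + 3 + (e + 2)))"
    using 1 by (intro comm_prod_wrap1[OF xy(1,2)]) simp
  then show ?thesis by (simp add: add.commute del: comm_prod.simps)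
qed

text \<open>Each reversal removes two factors \<open>xy\<close>. At the end \<open>x^i y^i\<close>
  is one commutator, and a leftover \<open>xy\<close> for odd \<open>v\<close> is another.\<close>

lemma comm_prod_pow_bound:
  assumes "x \<in> carrier G" "y \<in> carrier G" "conj_inv x y" "(v + 1) div 2 + 1 \<le> k"
  shows "comm_prod k (x [^] (i :: nat) \<otimes> y [^] i \<otimes> (x \<otimes> y) [^] (v :: nat))"
  using assms(4)
proof (induction v arbitrary: i k rule: less_induct)
  case (less v)
  have xyi: "comm_prod 1 (x [^] i \<otimes> y [^] i)" for i :: nat
    by (rule comm_prod_conj_inv[OF conj_inv_pow]) (use assms in auto)
  consider "v = 0" | "v = 1" | v' where "v = v' + 2" by (metis One_nat_def add_2_eq_Suc' not0_implies_Suc)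
  then show ?case
  proof cases
    case 1
    then show ?thesis using comm_prod_mono[OF xyi[of i], of k] less.prems assms(1,2) by simp
  next
    case 2
    have "comm_prod (1 + 1) ((x [^] i \<otimes> y [^] i) \<otimes> (x [^] (1 :: nat) \<otimes> y [^] (1 :: nat)))"
      by (rule comm_prod_mult[OF xyi xyi])
    then show ?thesis using comm_prod_mono[of 2 _ k] less.prems 2 assms(1,2)
      by (simp add: numeral_2_eq_2 del: comm_prod.simps)
  next
    case (3 v')
    then obtain k' where "k = Suc k'" "(v' + 1) div 2 + 1 \<le> k'" using less.prems by (cases k) auto
    then show ?thesis using comm_prod_step[OF assms(1,2)] less.IH[of v' k' "i + 2"] 3 by simp
  qed
qed

end

section \<open>Upper bounds in the presence of torsion\<close>

lemma div_less_half:
  fixes i v m :: nat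
  assumes "3 \<le> m" "i < m"
  shows "(i + v) div m < (v + 1) div 2 + 1"
proof -
  define d where "d = (i + v) div m"
  have "d * m \<le> i + v" unfolding d_def by (rule div_times_less_eq_dividend)
  show ?thesis
  proof (cases d)
    case (Suc e)
    then have "e * m + m \<le> i + v" using \<open>d * m \<le> i + v\<close> by simp
    then have "e * m < v" using assms(2) by linarith
    moreover have "e * 3 \<le> e * m" using assms(1) by simp
    ultimately have "e * 3 < v" by linarith
    then show ?thesis using Suc unfolding d_def[symmetric] by linarith
  qed (simp add: d_def)
qed

context group
begin

text \<open>The quotient \<open>(i + v) div m\<close> counts the multiples of \<open>m\<close> that
  the exponent can still reach, and each saves a commutator. Exponents up to \<open>m - 3\<close>
  take the ordinary step, while \<open>m - 2\<close> and \<open>m - 1\<close> use the wrapping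
  lemmas once enough factors remain. The induction varies \<open>x\<close> and \<open>y\<close>,
  which the step from \<open>m - 1\<close> exchanges.\<close>

lemma comm_prod_torsion_bound:
  assumes m: "3 \<le> m"
  shows "x \<in> carrier G \<Longrightarrow> y \<in> carrier G \<Longrightarrow> conj_inv x y \<Longrightarrow> x [^] m = \<one> \<Longrightarrow> y [^] m = \<one> \<Longrightarrow>
    1 \<le> i \<Longrightarrow> i < m \<Longrightarrow> (v + 1) div 2 + 1 \<le> k + (i + v) div m \<Longrightarrow>
    comm_prod k (x [^] (i :: nat) \<otimes> y [^] i \<otimes> (x \<otimes> y) [^] (v :: nat))"
proof (induction v arbitrary: x y i k rule: less_induct)
  case (less v)
  note xy = less.prems(1,2) and ci = less.prems(3) and tor = less.prems(4,5)
    and im = less.prems(6,7) and kb = less.prems(8)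
  have xyi: "comm_prod 1 (x [^] i \<otimes> y [^] i)" for i :: nat
    by (rule comm_prod_conj_inv[OF conj_inv_pow]) (use xy ci in auto)
  have xy1: "comm_prod 1 (x \<otimes> y)" by (rule comm_prod_conj_inv[OF ci xy(1)])
  have "k > 0" using div_less_half[OF m im(2), of v] kb by linarith
  then obtain k' where k': "k = Suc k'" by (cases k) auto
  show ?case
  proof (cases "v = 0 \<or> i + v < m")
    case True
    then have "(i + v) div m = 0" using im(2) by auto
    then show ?thesis using comm_prod_pow_bound[OF xy ci] kb by simp
  next
    case v0: False
    consider "i + 3 \<le> m" | "i + 2 = m" | "i + 1 = m" using im(2) by linarith
    then show ?thesis
    proof cases
      case 1
      then have "\<exists>v'. v = v' + 2" using v0 by presburger
      then obtain v' where v': "v = v' + 2" by blast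
      have "comm_prod k' (x [^] (i + 2) \<otimes> y [^] (i + 2) \<otimes> (x \<otimes> y) [^] v')"
        using less.IH[of v' x y "i + 2" k'] xy ci tor 1 kb k' v' by simp
      then show ?thesis using comm_prod_step[OF xy] k' v' by simp
    next
      case 2
      then have v2: "v \<ge> 2" using v0 by linarith
      have X1: "x [^] i \<otimes> (x \<otimes> x) = \<one>" "y \<otimes> (y [^] i \<otimes> y) = \<one>"
      proof -
        have "x [^] (i + 2) = \<one>" "y [^] (i + 2) = \<one>" using tor 2 by simp_all
        then show "x [^] i \<otimes> (x \<otimes> x) = \<one>" "y \<otimes> (y [^] i \<otimes> y) = \<one>"
          using xy by (simp_all add: m_assoc pow_commute)
      qed
      have "v = 2 \<or> v = 3 \<or> (\<exists>v'. v = v' + 4)" using v2 by presburger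
      \<comment> \<open>With two or three factors \<open>xy\<close> left, an ordinary step ends at
        \<open>x^m y^m = 1\<close>, followed by at most one \<open>xy\<close>.\<close>
      then consider "v = 2" | "v = 3" | v' where "v = v' + 4" by blast
      then show ?thesis
      proof cases
        case v: 1
        have "comm_prod k' (x [^] (i + 2) \<otimes> y [^] (i + 2) \<otimes> (x \<otimes> y) [^] (0 :: nat))"
          using comm_prod_mono[of 0 \<one> k'] tor unfolding 2 by simp
        from comm_prod_step[OF xy this] show ?thesis unfolding k' v by (simp only: add_0)
      next
        case v: 2
        have "(i + v) div m = 1" using 2 v m by (simp add: div_nat_eqI)
        then have "1 \<le> k'" using kb k' v by simp
        then have "comm_prod k' (x [^] (i + 2) \<otimes> y [^] (i + 2) \<otimes> (x \<otimes> y) [^] (1 :: nat))"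
          using comm_prod_mono[OF xy1, of k'] tor xy unfolding 2 by simp
        from comm_prod_step[OF xy this] show ?thesis
          unfolding k' v by (simp only: one_plus_numeral add_num_simps)
      next
        case v: (3 v')
        have iv: "i + v = m + (2 + v')" using 2 v by simp
        have "(i + v) div m = (2 + v') div m + 1" unfolding iv by (rule div_add_self1) (use m in simp)
        then have "(v' + 1) div 2 + 1 \<le> k' + (2 + v') div m" using kb k' v by simp
        then have "comm_prod k' (x [^] (2 :: nat) \<otimes> y [^] (2 :: nat) \<otimes> (x \<otimes> y) [^] v')"
          using less.IH[of v' x y 2 k'] xy ci tor m v by simp
        then show ?thesis using comm_prod_wrap2[OF xy _ _ X1] xy k' v by simp
      qed
    next
      case 3
      then have xinv: "x [^] i = inv x" "y [^] i = inv y"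
      proof -
        have "x [^] i \<otimes> x = \<one>" "y [^] i \<otimes> y = \<one>" using tor unfolding 3[symmetric] by simp_all
        then show "x [^] i = inv x" "y [^] i = inv y" using xy by (simp_all add: inv_equality)
      qed
      have cis: "conj_inv y x" by (rule conj_inv_sym[OF ci xy(1)])
      have "v = 1 \<or> v = 2 \<or> v = 3 \<or> (\<exists>v'. v = v' + 4)" using v0 by presburger
      then consider "v = 1" | "v = 2" | "v = 3" | v' where "v = v' + 4" by blast
      then show ?thesis
      proof cases
        case 1
        have "inv x \<otimes> inv y \<otimes> (x \<otimes> y) = commutator G x y \<otimes> \<one>"
          using xy by (simp add: commutator_def m_assoc)
        then have "comm_prod 1 (inv x \<otimes> inv y \<otimes> (x \<otimes> y))" using xy by (auto simp del: r_one)
        from comm_prod_mono[OF this, of k] show ?thesis using 1 \<open>k > 0\<close> xy by (simp add: xinv)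
      next
        case 2
        \<comment> \<open>The word \<open>x^-1 y^-1 (xy)^2\<close> is a conjugate of
          \<open>x\<close> times \<open>y\<close>, hence a single commutator.\<close>
        have "conj_inv y (inv (y \<otimes> x) \<otimes> x \<otimes> (y \<otimes> x))"
          by (rule conj_inv_conj[OF cis]) (use xy in auto)
        then have "conj_inv (inv (y \<otimes> x) \<otimes> x \<otimes> (y \<otimes> x)) y" by (rule conj_inv_sym) (use xy in auto)
        then have "comm_prod 1 (inv (y \<otimes> x) \<otimes> x \<otimes> (y \<otimes> x) \<otimes> y)"
          by (rule comm_prod_conj_inv) (use xy in auto)
        moreover have "inv (y \<otimes> x) \<otimes> x \<otimes> (y \<otimes> x) \<otimes> y = inv x \<otimes> inv y \<otimes> (x \<otimes> y) [^] (2 :: nat)"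
          using xy by (simp add: m_assoc inv_mult_group numeral_2_eq_2)
        ultimately have "comm_prod 1 (inv x \<otimes> inv y \<otimes> (x \<otimes> y) [^] (2 :: nat))" by metis
        from comm_prod_mono[OF this, of k] show ?thesis using 2 \<open>k > 0\<close> by (simp add: xinv)
      next
        case v: 3
        have "(i + v) div m = 1" using 3 v m by (simp add: div_nat_eqI)
        then have "2 \<le> k" using kb k' v by simp
        have "comm_prod 1 (y [^] (2 :: nat) \<otimes> x [^] (2 :: nat))"
          by (rule comm_prod_conj_inv[OF conj_inv_pow]) (use xy cis in auto)
        then have "comm_prod 1 (y \<otimes> (y \<otimes> (x \<otimes> (x \<otimes> ((y \<otimes> x) [^] (0 :: nat) \<otimes> (x \<otimes> y) [^] (0 :: nat))))))"
          using xy by (simp add: numeral_2_eq_2 m_assoc del: comm_prod.simps)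
        from comm_prod_mono[OF comm_prod_wrap1[OF xy this], of k] \<open>2 \<le> k\<close> show ?thesis
          using v by (simp add: xinv numeral_2_eq_2 del: comm_prod.simps)
      next
        case v: (4 v')
        have iv: "i + v = m + (3 + v')" using 3 v by simp
        have "(i + v) div m = (3 + v') div m + 1" unfolding iv by (rule div_add_self1) (use m in simp)
        then have k2: "(v' + 1) div 2 + 1 \<le> k' + (3 + v') div m" using kb k' v by simp
        show ?thesis
        proof (cases "m = 3")
          case False
          then have "comm_prod k' (y [^] (3 :: nat) \<otimes> x [^] (3 :: nat) \<otimes> (y \<otimes> x) [^] v')"
            using less.IH[of v' y x 3 k'] xy cis tor m v k2 by simp
          from comm_prod_wrap1_cubes[OF xy this] show ?thesis unfolding k' v xinv .
        next
          \<comment> \<open>The exponent 3 is out of range for the induction when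
            \<open>m = 3\<close>. For \<open>v' \<le> 1\<close> the vanishing cubes suffice;
            otherwise six factors are absorbed at once.\<close>
          case m3: True
          have x3: "x \<otimes> (x \<otimes> x) = \<one>" "y \<otimes> (y \<otimes> y) = \<one>"
            using tor xy unfolding m3 by (simp_all add: numeral_3_eq_3 m_assoc)
          consider "v' = 0" | "v' = 1" | e where "v' = e + 2"
            by (metis One_nat_def add_2_eq_Suc' not0_implies_Suc)
          then show ?thesis
          proof cases
            case 1
            have "comm_prod k' \<one>" using comm_prod_mono[of 0 \<one> k'] by simp
            then have "comm_prod k' (y [^] (3 :: nat) \<otimes> x [^] (3 :: nat) \<otimes> (y \<otimes> x) [^] v')"
              using tor 1 unfolding m3 by simp
            from comm_prod_wrap1_cubes[OF xy this] show ?thesis unfolding k' v xinv .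
          next
            case 2
            then have "1 \<le> k'" using k2 m3 by simp
            moreover have "comm_prod 1 (y \<otimes> x)" by (rule comm_prod_conj_inv[OF cis xy(2)])
            ultimately have "comm_prod k' (y [^] (3 :: nat) \<otimes> x [^] (3 :: nat) \<otimes> (y \<otimes> x) [^] v')"
              using comm_prod_mono[of 1 "y \<otimes> x" k'] tor 2 xy unfolding m3 by simp
            from comm_prod_wrap1_cubes[OF xy this] show ?thesis unfolding k' v xinv .
          next
            case e: (3 e)
            have "(3 + v') div m = Suc ((2 + e) div m)" unfolding m3 e by presburger
            then have "(e + 1) div 2 + 1 \<le> k' + (2 + e) div m" using k2 e by simp
            then have "comm_prod k' (y [^] (2 :: nat) \<otimes> x [^] (2 :: nat) \<otimes> (y \<otimes> x) [^] e)"
              using less.IH[of e y x 2 k'] xy cis tor m v e by simp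
            from comm_prod_wrap1_order3[OF xy x3 this]
            show ?thesis unfolding k' v e xinv by (simp only: add.assoc numeral_plus_numeral add_num_simps)
          qed
        qed
      qed
    qed
  qed
qed

text \<open>Dihedral case: \<open>x h^-1 = h x\<close> for \<open>h = (xy)^k\<close>. Hence
  \<open>(xy)^n\<close> is \<open>x\<close> times a conjugate of \<open>y\<close> for odd
  \<open>n\<close> and of \<open>x = x^-1\<close> for even \<open>n\<close>.\<close>

lemma comm_prod_involutions:
  assumes xy: "x \<in> carrier G" "y \<in> carrier G" and ci: "conj_inv x y"
    and inv2: "inv x = x" "inv y = y" and n: "n > 0"
  shows "comm_prod 1 ((x \<otimes> y) [^] (n :: nat))"
proof -
  have "\<exists>k. n = 2 * k + 1 \<or> n = 2 * k + 2" using n by presburger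
  then obtain k where k: "n = 2 * k + 1 \<or> n = 2 * k + 2" by blast
  define h where "h = (x \<otimes> y) [^] k"
  have h: "h \<in> carrier G" using xy by (simp add: h_def)
  have hi: "inv h = (y \<otimes> x) [^] k"
    unfolding h_def using xy by (simp add: nat_pow_inv[symmetric] inv_mult_group inv2)
  have xh: "x \<otimes> inv h = h \<otimes> x" using pow_mult_shift[of y x k] xy by (simp add: hi h_def[symmetric])
  have split: "(x \<otimes> y) [^] (2 * k + 1) = h \<otimes> (x \<otimes> (y \<otimes> h))"
    "(x \<otimes> y) [^] (2 * k + 2) = h \<otimes> (x \<otimes> (y \<otimes> (x \<otimes> (y \<otimes> h))))"
  proof -
    have e: "2 * k + 1 = k + Suc k" "2 * k + 2 = k + Suc (Suc k)" by simp_all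
    have c: "x \<otimes> y \<in> carrier G" using xy by simp
    show "(x \<otimes> y) [^] (2 * k + 1) = h \<otimes> (x \<otimes> (y \<otimes> h))"
      unfolding e nat_pow_mult[OF c, symmetric] nat_pow_Suc2[OF c] h_def using xy by (simp add: m_assoc)
    show "(x \<otimes> y) [^] (2 * k + 2) = h \<otimes> (x \<otimes> (y \<otimes> (x \<otimes> (y \<otimes> h))))"
      unfolding e nat_pow_mult[OF c, symmetric] nat_pow_Suc2[OF c] h_def using xy by (simp add: m_assoc)
  qed
  show ?thesis
    using k
  proof
    assume n: "n = 2 * k + 1"
    have "comm_prod 1 (x \<otimes> (inv h \<otimes> y \<otimes> h))"
      by (rule comm_prod_conj_inv[OF conj_inv_conj[OF ci xy(1) h] xy(1)])
    moreover have "x \<otimes> (inv h \<otimes> y \<otimes> h) = (x \<otimes> inv h) \<otimes> (y \<otimes> h)" using xy h by (simp add: m_assoc)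
    ultimately show ?thesis unfolding n split xh using xy h by (simp add: m_assoc)
  next
    assume n: "n = 2 * k + 2"
    have "conj_inv x (inv (y \<otimes> h) \<otimes> x \<otimes> (y \<otimes> h))"
      by (rule conj_invI[of "y \<otimes> h"]) (use xy h inv2 in auto)
    then have "comm_prod 1 (x \<otimes> (inv (y \<otimes> h) \<otimes> x \<otimes> (y \<otimes> h)))" by (rule comm_prod_conj_inv[OF _ xy(1)])
    moreover have "x \<otimes> (inv (y \<otimes> h) \<otimes> x \<otimes> (y \<otimes> h)) = (x \<otimes> inv h) \<otimes> (y \<otimes> (x \<otimes> (y \<otimes> h)))"
      using xy h by (simp add: m_assoc inv_mult_group inv2)
    ultimately show ?thesis unfolding n split xh using xy h by (simp add: m_assoc)
  qed
qed

lemma comm_prod_power: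
  assumes xy: "x \<in> carrier G" "y \<in> carrier G" and ci: "conj_inv x y" and n: "n > 0"
    and m: "m = 0 \<or> 2 \<le> m \<and> x [^] m = \<one> \<and> y [^] m = \<one>" and k: "n div 2 + 1 \<le> k + n div m"
  shows "comm_prod k ((x \<otimes> y) [^] (n :: nat))"
proof -
  obtain v where v: "n = Suc v" using n by (cases n) auto
  \<comment> \<open>One factor is split off to start the induction at exponent
    \<open>i = 1\<close>.\<close>
  have T: "(x \<otimes> y) [^] n = x [^] (1 :: nat) \<otimes> y [^] (1 :: nat) \<otimes> (x \<otimes> y) [^] v"
    unfolding v using nat_pow_Suc2[of "x \<otimes> y" v] xy by simp
  consider "m = 0" | "m = 2" | "3 \<le> m" using m by linarith
  then show ?thesis
  proof cases
    case 1
    then show ?thesis unfolding T using comm_prod_pow_bound[OF xy ci, of v k 1] k v by simp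
  next
    case 2
    then have "x \<otimes> x = \<one>" "y \<otimes> y = \<one>" using m xy by (simp_all add: numeral_2_eq_2)
    then have "inv x = x" "inv y = y" using xy by (simp_all add: inv_equality)
    from comm_prod_mono[OF comm_prod_involutions[OF xy ci this n], of k] show ?thesis using k 2 by simp
  next
    case 3
    then show ?thesis unfolding T
      using comm_prod_torsion_bound[OF 3 xy ci, of 1 v k] m k v by simp
  qed
qed

end

subsection \<open>Commutator length of the powers\<close>

context group_family
begin

lemma free_product_letter_pow:
  assumes "j \<in> J" "x \<in> carrier (A j)"
  shows "fp_incl A j x [^]\<^bsub>free_product A J\<^esub> (r :: nat) = fp_incl A j (x [^]\<^bsub>A j\<^esub> r)"
proof (induction r)
  case 0
  interpret group "A j" by (rule is_group[OF assms(1)])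
  show ?case by (simp add: free_product_simps fp_incl_def)
next
  case (Suc r)
  interpret group "A j" by (rule is_group[OF assms(1)])
  interpret G: group "free_product A J" by (rule free_product_group)
  have "fp_incl A j y \<otimes>\<^bsub>free_product A J\<^esub> fp_incl A j z = fp_incl A j (y \<otimes>\<^bsub>A j\<^esub> z)"
    if "y \<in> carrier (A j)" "z \<in> carrier (A j)" for y z
    using that by (auto simp: free_product_simps fp_incl_def)
  then show ?case using Suc assms(2) by simp
qed

text \<open>Letters of one factor never meet, neither within the commutator nor between successive
  copies, so nothing is reduced.\<close>

lemma commutator_letters:
  assumes "j1 \<in> J" "j2 \<in> J" "j1 \<noteq> j2" "a \<in> carrier (A j1)" "a \<noteq> \<one>\<^bsub>A j1\<^esub>"
    "t \<in> carrier (A j2)" "t \<noteq> \<one>\<^bsub>A j2\<^esub>"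
  shows "commutator (free_product A J) (fp_incl A j1 a) (fp_incl A j2 t) [^]\<^bsub>free_product A J\<^esub> (n :: nat)
    = concat (replicate n [(j1, inv\<^bsub>A j1\<^esub> a), (j2, inv\<^bsub>A j2\<^esub> t), (j1, a), (j2, t)])"
proof -
  interpret G: group "free_product A J" by (rule free_product_group)
  interpret A1: group "A j1" by (rule is_group[OF assms(1)])
  interpret A2: group "A j2" by (rule is_group[OF assms(2)])
  let ?C = "[(j1, inv\<^bsub>A j1\<^esub> a), (j2, inv\<^bsub>A j2\<^esub> t), (j1, a), (j2, t)]"
  have ne: "inv\<^bsub>A j1\<^esub> a \<noteq> \<one>\<^bsub>A j1\<^esub>" "inv\<^bsub>A j2\<^esub> t \<noteq> \<one>\<^bsub>A j2\<^esub>" using assms by simp_all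
  have red: "reduced [(j1, a)]" "reduced [(j2, t)]" "reduced ?C"
    using assms ne by (auto simp: reduced_Cons reduced_Nil in_letters)
  have C: "commutator (free_product A J) (fp_incl A j1 a) (fp_incl A j2 t) = ?C"
    using assms ne red by (simp add: commutator_def fp_incl_def free_product_inv word_inv_def free_product_simps)
  have "?C [^]\<^bsub>free_product A J\<^esub> n = concat (replicate n ?C)"
  proof (induction n)
    case 0
    show ?case by (simp add: free_product_simps)
  next
    case (Suc n)
    have "?C [^]\<^bsub>free_product A J\<^esub> Suc n = ?C \<otimes>\<^bsub>free_product A J\<^esub> concat (replicate n ?C)"
      using G.nat_pow_Suc2[of ?C n] red(3) Suc by (simp add: free_product_simps(1))
    also have "\<dots> = ?C @ concat (replicate n ?C)"
      using assms ne by (cases n) (auto simp: free_product_simps(3))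
    finally show ?case by simp
  qed
  then show ?thesis unfolding C .
qed

end

theorem theorem3:
  fixes A :: "'j \<Rightarrow> 'a monoid" and J :: "'j set"
    and j1 j2 :: 'j and a t :: 'a and n :: nat
  assumes groups: "\<And>j. j \<in> J \<Longrightarrow> group (A j)"
    and nontriv: "\<And>j. j \<in> J \<Longrightarrow> carrier (A j) \<noteq> {\<one>\<^bsub>A j\<^esub>}"
    and n_pos: "n > 0"
    and j1: "j1 \<in> J" and j2: "j2 \<in> J" and j12: "j1 \<noteq> j2"
    and a: "a \<in> carrier (A j1)" "a \<noteq> \<one>\<^bsub>A j1\<^esub>"
    and t: "t \<in> carrier (A j2)" "t \<noteq> \<one>\<^bsub>A j2\<^esub>"
    and ord_le: "elem_ord (A j1) a \<le> elem_ord (A j2) t"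
  shows "int (commutator_length (free_product A J)
            (commutator (free_product A J) (fp_incl A j1 a) (fp_incl A j2 t) [^]\<^bsub>free_product A J\<^esub> n))
         = int (n div 2) - int (floor_div_ord n (elem_ord (A j1) a)) + 1"
proof -
  interpret group_family A J by (rule group_family.intro) (rule groups)
  interpret G: group "free_product A J" by (rule free_product_group)
  interpret A1: group "A j1" by (rule groups[OF j1])
  interpret A2: group "A j2" by (rule groups[OF j2])
  let ?G = "free_product A J"
  \<comment> \<open>An infinite order is represented by \<open>0\<close>, and
    \<open>n div 0 = 0\<close> agrees with the convention for the integer part.\<close>
  define m where "m = A1.ord a"
  have fd: "floor_div_ord n (elem_ord (A j1) a) = n div m"
    by (simp add: floor_div_ord_def elem_ord_def m_def)
  define h where "h = commutator ?G (fp_incl A j1 a) (fp_incl A j2 t) [^]\<^bsub>?G\<^esub> n"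
  define P where "P = (\<lambda>k. \<exists>f g. (\<forall>i<k. f i \<in> carrier ?G \<and> g i \<in> carrier ?G) \<and> h = comm_product ?G f g k)"
  have orda: "0 < m \<and> m \<le> r" if "r > 0" "a [^]\<^bsub>A j1\<^esub> (r :: nat) = \<one>\<^bsub>A j1\<^esub>" for r
  proof -
    have "m dvd r" using that a A1.pow_eq_id by (simp add: m_def)
    then show ?thesis using that(1) by (auto dest: dvd_imp_le intro!: Nat.gr0I)
  qed
  \<comment> \<open>If some positive power of \<open>t\<close> is trivial, \<open>ord_le\<close>
    makes the order of \<open>a\<close> finite as well.\<close>
  have ordt: "0 < m \<and> m \<le> r" if "r > 0" "t [^]\<^bsub>A j2\<^esub> (r :: nat) = \<one>\<^bsub>A j2\<^esub>" for r
  proof -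
    have "A2.ord t dvd r" using that t A2.pow_eq_id by simp
    then have "0 < A2.ord t" "A2.ord t \<le> r" using that(1) by (auto dest: dvd_imp_le intro!: Nat.gr0I)
    moreover from this have "0 < m \<and> m \<le> A2.ord t"
      using ord_le by (auto simp: elem_ord_def m_def split: if_splits)
    ultimately show ?thesis by simp
  qed
  have h_word: "h = concat (replicate n [(j1, inv\<^bsub>A j1\<^esub> a), (j2, inv\<^bsub>A j2\<^esub> t), (j1, a), (j2, t)])"
    unfolding h_def by (rule commutator_letters[OF j1 j2 j12 a t])
  have lower: "int (n div 2) - int (n div m) + 1 \<le> int k" if "P k" for k
  proof -
    from that obtain f g where fg: "\<And>i. i < k \<Longrightarrow> f i \<in> carrier ?G \<and> g i \<in> carrier ?G"
      "h = comm_product ?G f g k" unfolding P_def by blast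
    have "h \<noteq> []" using n_pos by (simp add: h_word)
    then have "fills h (1 - 2 * int k)" using fills_comm_product[OF fg(1) _ j1] fg(2) by simp
    then have "1 - 2 * int k \<le> 2 * int (n div m) - int n"
      unfolding h_word by (intro fills_commutator_power[OF j1 j2 j12 a(1) t(1) n_pos orda ordt])
    \<comment> \<open>Halving \<open>n + 1 \<le> 2 * (k + n div m)\<close> and rounding up gives
      \<open>n div 2 + 1\<close> on the left.\<close>
    then show ?thesis by linarith
  qed
  define k where "k = n div 2 + 1 - n div m"
  have "P k"
  proof -
    let ?a = "fp_incl A j1 a" and ?t = "fp_incl A j2 t"
    have ca: "?a \<in> carrier ?G" and ct: "?t \<in> carrier ?G"
      using a t j1 j2 by (auto simp: free_product_simps fp_incl_def reduced_Cons reduced_Nil in_letters)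
    define x y where "x = inv\<^bsub>?G\<^esub> ?a" and "y = inv\<^bsub>?G\<^esub> ?t \<otimes>\<^bsub>?G\<^esub> ?a \<otimes>\<^bsub>?G\<^esub> ?t"
    have xy: "x \<in> carrier ?G" "y \<in> carrier ?G" using ca ct by (simp_all add: x_def y_def)
    have ci: "G.conj_inv x y" by (rule G.conj_invI[OF ct]) (simp add: x_def y_def ca)
    have "?a [^]\<^bsub>?G\<^esub> m = \<one>\<^bsub>?G\<^esub>"
      unfolding free_product_letter_pow[OF j1 a(1)] m_def A1.pow_ord_eq_1[OF a(1)]
      by (simp add: fp_incl_def free_product_simps)
    then have "x [^]\<^bsub>?G\<^esub> m = \<one>\<^bsub>?G\<^esub>" "y [^]\<^bsub>?G\<^esub> m = \<one>\<^bsub>?G\<^esub>"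
      using ca ct by (simp_all add: x_def y_def G.nat_pow_inv G.nat_pow_conj)
    moreover have "m = 0 \<or> 2 \<le> m"
    proof -
      have "m \<noteq> 1" using a A1.ord_eq_1 by (simp add: m_def)
      then show ?thesis by linarith
    qed
    ultimately have "G.comm_prod k ((x \<otimes>\<^bsub>?G\<^esub> y) [^]\<^bsub>?G\<^esub> n)"
      by (intro G.comm_prod_power[OF xy ci n_pos, of m]) (auto simp: k_def)
    moreover have "x \<otimes>\<^bsub>?G\<^esub> y = commutator ?G ?a ?t"
      using ca ct by (simp add: x_def y_def commutator_def G.m_assoc)
    ultimately have "G.comm_prod k h" by (simp add: h_def)
    then show ?thesis unfolding P_def by (rule G.comm_prod_imp_comm_product)
  qed
  have "commutator_length ?G h = (LEAST k. P k)" by (simp add: commutator_length_def P_def)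
  moreover have "(LEAST k. P k) \<le> k" by (rule Least_le[of P, OF \<open>P k\<close>])
  moreover have "int (n div 2) - int (n div m) + 1 \<le> int (LEAST k. P k)" by (rule lower[OF LeastI[of P, OF \<open>P k\<close>]])
  \<comment> \<open>Ensures that the natural-number subtraction in \<open>k\<close> does not
    truncate.\<close>
  moreover have "n div m \<le> n div 2 + 1"
  proof (cases "m = 0")
    case False
    moreover have "m \<noteq> 1" using a A1.ord_eq_1 by (simp add: m_def)
    ultimately have "n div m \<le> n div 2" by (intro div_le_mono2) auto
    then show ?thesis by simp
  qed simp
  ultimately show ?thesis unfolding fd h_def[symmetric] by (simp add: k_def)
qed

end
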